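(* Jones' subgroup $\overrightarrow F$ of R. Thompson's group $F$ (the set of all reduced diagrams $\Delta$ in $F$ whose Thompson graph $T(\Delta)$ is bipartite) is the stabilizer, under the standard action of $F$ on $[0,1]$, of the set of dyadic fractions from the unit interval $[0,1]$ with odd sums of (binary) digits.
   Context: $F$ is the group of all piecewise-linear increasing homeomorphisms of $[0,1]$ with all slopes powers of $2$ and all break points of the derivative dyadic fractions; products are composed from left to right. The sum of digits of a dyadic fraction is the sum of the digits of its finite binary expansion. The stabilizer of a set $S\subseteq[0,1]$ is $\{g\in F: g(S)=S\}$. Diagrams: the cell $\pi$ is the plane directed graph whose top path is one edge and whose bottom path consists of two edges, with the same initial and terminal vertices (all edges are directed left to right). Diagrams over $\langle x\mid x=x^2\rangle$ are the plane graphs (up to isotopy) obtained from the single edge $\mathbf 1$ and from $\pi$ by addition $\Delta_1+\Delta_2$ (identify the terminal vertex of $\Delta_1$ with the initial vertex of $\Delta_2$), multiplication $\Delta_1\circ\Delta_2$ (identify the bottom path of $\Delta_1$ with the top path of $\Delta_2$ when they have the same length), and inversion (reflection in a horizontal line). A diagram $\Delta$ has an initial vertex $\iota(\Delta)$ and a terminal vertex $\tau(\Delta)$; the other vertices are called inner. A dipole is a subdiagram $\pi\circ\pi^{-1}$ or $\pi^{-1}\circ\pi$; it is eliminated by removing its two cells and identifying its top and bottom paths. A diagram is reduced if it has no dipoles; each diagram is equivalent via dipole moves to a unique reduced diagram. "Diagrams in $F$" are those whose top path and bottom path are single edges; reduced such diagrams, with product = reduced form of $\Delta_1\circ\Delta_2$,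 form a group identified with $F$ as follows. A reduced $\Delta$ is cut by its longest positive path from $\iota(\Delta)$ to $\tau(\Delta)$ as $\Delta=\Delta^+\circ\Delta^-$, where $\Delta^+$ consists of cells $\pi$ and $\Delta^-$ of cells $\pi^{-1}$. Assign $[0,1]$ to the top edge of $\Delta^+$ and, for each cell, the left and right halves of the interval of its top edge to its left and right bottom edges; the bottom path of $\Delta^+$ gives a dyadic subdivision of $[0,1]$ (top subdivision). Doing the same with $(\Delta^-)^{-1}$ gives the bottom subdivision. $\Delta$ corresponds to the homeomorphism mapping each segment of the top subdivision linearly onto the corresponding segment of the bottom subdivision. Thompson graph $T(\Delta)$: its vertices are all vertices of $\Delta$ except $\tau(\Delta)$; its edges are, for every inner vertex $v$ of $\Delta$, the top-most incoming edge of $v$ in $\Delta$ (upper edge) and the bottom-most incoming edge of $v$ in $\Delta$ (lower edge), counted as two distinct edges if they coincide. *)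

theory Defs
  imports "HOL-Analysis.Analysis" "Graph_Theory.Graph_Theory"
begin

section \<open>Thompson's group F acting on the unit interval\<close>

definition dyadic :: "real set" where
  "dyadic = {of_int m / 2 ^ n | (m::int) (n::nat). True}"

text \<open>The finite set \<open>B\<close> contains the break points of the derivative.  A self-map of the
  unit interval is represented by the function on the reals that is the identity elsewhere.\<close>

definition thompson_F :: "(real \<Rightarrow> real) set" where
  "thompson_F = {g.
     (\<exists>h. homeomorphism {0..1} {0..1} g h) \<and>
     strict_mono_on {0..1} g \<and>
     (\<exists>B \<subseteq> dyadic. finite B \<and>
        (\<forall>a b. 0 \<le> a \<and> a < b \<and> b \<le> 1 \<and> {a<..<b} \<inter> B = {} \<longrightarrow>
           (\<exists>(k::int) c. \<forall>x\<in>{a..b}. g x = 2 powi k * x + c))) \<and>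
     (\<forall>x. x \<notin> {0..1} \<longrightarrow> g x = x)}"

definition stabilizer_F :: "real set \<Rightarrow> (real \<Rightarrow> real) set" where
  "stabilizer_F S = {g \<in> thompson_F. g ` S = S}"

text \<open>\<open>d 0\<close> is the digit before the binary point, nonzero only for \<open>x = 1\<close> in the unit
  interval.\<close>

definition binary_expansion :: "nat \<Rightarrow> (nat \<Rightarrow> nat) \<Rightarrow> real \<Rightarrow> bool" where
  "binary_expansion n d x \<longleftrightarrow>
     (\<forall>i\<le>n. d i \<in> {0, 1}) \<and> x = (\<Sum>i\<le>n. real (d i) / 2 ^ i)"

definition odd_digit_sum_dyadics :: "real set" where
  "odd_digit_sum_dyadics =
     {x \<in> {0..1}. \<exists>n d. binary_expansion n d x \<and> odd (\<Sum>i\<le>n. d i)}"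


section \<open>Diagrams over the presentation \<open>x = x\<^sup>2\<close>\<close>

text \<open>A plane graph up to isotopy is encoded by its directed graph, its top and bottom paths and
  its cells, each cell being given by its own top and bottom paths (lists of edges from left to
  right).  The names of vertices and edges carry no information: the class of diagrams below
  contains all renamings of each diagram.\<close>

record diagram =
  graph :: "(nat, nat) pre_digraph"
  top_path :: "nat list"
  bot_path :: "nat list"
  cells :: "(nat list \<times> nat list) set"

definition init_vertex :: "diagram \<Rightarrow> nat" where
  "init_vertex D = tail (graph D) (hd (top_path D))"

definition term_vertex :: "diagram \<Rightarrow> nat" where
  "term_vertex D = head (graph D) (last (top_path D))"

definition inner_verts :: "diagram \<Rightarrow> nat set" where
  "inner_verts D = verts (graph D) - {init_vertex D, term_vertex D}"

definition edge_diagram :: "diagram \<Rightarrow> bool" where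
  "edge_diagram D \<longleftrightarrow>
     (\<exists>u v e. u \<noteq> v \<and> verts (graph D) = {u, v} \<and> arcs (graph D) = {e} \<and>
        tail (graph D) e = u \<and> head (graph D) e = v \<and>
        top_path D = [e] \<and> bot_path D = [e] \<and> cells D = {})"

definition pi_diagram :: "diagram \<Rightarrow> bool" where
  "pi_diagram D \<longleftrightarrow>
     (\<exists>u w v e l r. distinct [u, w, v] \<and> distinct [e, l, r] \<and>
        verts (graph D) = {u, w, v} \<and> arcs (graph D) = {e, l, r} \<and>
        tail (graph D) e = u \<and> head (graph D) e = v \<and>
        tail (graph D) l = u \<and> head (graph D) l = w \<and>
        tail (graph D) r = w \<and> head (graph D) r = v \<and>
        top_path D = [e] \<and> bot_path D = [l, r] \<and> cells D = {([e], [l, r])})"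

text \<open>The operands of addition and multiplication are taken with names chosen such that they
  share exactly the part along which they are glued; the glued diagram is then their union.
  (\<open>compatible\<close> says that the incidence functions, which are total, agree.)\<close>

definition addable :: "diagram \<Rightarrow> diagram \<Rightarrow> bool" where
  "addable D E \<longleftrightarrow> compatible (graph D) (graph E) \<and>
     term_vertex D = init_vertex E \<and>
     verts (graph D) \<inter> verts (graph E) = {term_vertex D} \<and>
     arcs (graph D) \<inter> arcs (graph E) = {}"

definition dadd :: "diagram \<Rightarrow> diagram \<Rightarrow> diagram" where
  "dadd D E = \<lparr>graph = union (graph D) (graph E),
     top_path = top_path D @ top_path E, bot_path = bot_path D @ bot_path E,
     cells = cells D \<union> cells E\<rparr>"

definition multipliable :: "diagram \<Rightarrow> diagram \<Rightarrow> bool" where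
  "multipliable D E \<longleftrightarrow> compatible (graph D) (graph E) \<and>
     bot_path D = top_path E \<and>
     verts (graph D) \<inter> verts (graph E) =
       set (pre_digraph.awalk_verts (graph D) (init_vertex D) (bot_path D)) \<and>
     arcs (graph D) \<inter> arcs (graph E) = set (bot_path D)"

definition dmult :: "diagram \<Rightarrow> diagram \<Rightarrow> diagram" where
  "dmult D E = \<lparr>graph = union (graph D) (graph E),
     top_path = top_path D, bot_path = bot_path E, cells = cells D \<union> cells E\<rparr>"

definition dinv :: "diagram \<Rightarrow> diagram" where
  "dinv D = \<lparr>graph = graph D, top_path = bot_path D, bot_path = top_path D,
     cells = prod.swap ` cells D\<rparr>"

inductive is_diagram :: "diagram \<Rightarrow> bool" where
  edge: "edge_diagram D \<Longrightarrow> is_diagram D"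
| cell: "pi_diagram D \<Longrightarrow> is_diagram D"
| add: "is_diagram D \<Longrightarrow> is_diagram E \<Longrightarrow> addable D E \<Longrightarrow> is_diagram (dadd D E)"
| mult: "is_diagram D \<Longrightarrow> is_diagram E \<Longrightarrow> multipliable D E \<Longrightarrow> is_diagram (dmult D E)"
| inv: "is_diagram D \<Longrightarrow> is_diagram (dinv D)"

definition pi_cell :: "nat list \<times> nat list \<Rightarrow> bool" where
  "pi_cell c \<longleftrightarrow> length (fst c) = 1 \<and> length (snd c) = 2"

definition pi_inv_cell :: "nat list \<times> nat list \<Rightarrow> bool" where
  "pi_inv_cell c \<longleftrightarrow> length (fst c) = 2 \<and> length (snd c) = 1"

definition dipole :: "diagram \<Rightarrow> nat list \<times> nat list \<Rightarrow> nat list \<times> nat list \<Rightarrow> bool" where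
  "dipole D c c' \<longleftrightarrow> c \<in> cells D \<and> c' \<in> cells D \<and> snd c = fst c' \<and>
     (pi_cell c \<and> pi_inv_cell c' \<or> pi_inv_cell c \<and> pi_cell c')"

definition reduced :: "diagram \<Rightarrow> bool" where
  "reduced D \<longleftrightarrow> \<not> (\<exists>c c'. dipole D c c')"

definition diagram_in_F :: "diagram \<Rightarrow> bool" where
  "diagram_in_F D \<longleftrightarrow> is_diagram D \<and> length (top_path D) = 1 \<and> length (bot_path D) = 1"


section \<open>The homeomorphism of a reduced diagram\<close>

definition longest_positive_path :: "diagram \<Rightarrow> nat list \<Rightarrow> bool" where
  "longest_positive_path D p \<longleftrightarrow>
     pre_digraph.awalk (graph D) (init_vertex D) p (term_vertex D) \<and>
     (\<forall>q. pre_digraph.awalk (graph D) (init_vertex D) q (term_vertex D) \<longrightarrow> length q \<le> length p)"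

text \<open>\<open>edge_interval P e a b\<close>: the edge \<open>e\<close> of the diagram \<open>P\<close>, all of whose cells are \<open>\<pi>\<close>, is
  assigned the interval with end points \<open>a\<close> and \<open>b\<close>.\<close>

inductive edge_interval :: "diagram \<Rightarrow> nat \<Rightarrow> real \<Rightarrow> real \<Rightarrow> bool" for P where
  top: "top_path P = [e] \<Longrightarrow> edge_interval P e 0 1"
| left: "edge_interval P e a b \<Longrightarrow> ([e], [l, r]) \<in> cells P \<Longrightarrow> edge_interval P l a ((a + b) / 2)"
| right: "edge_interval P e a b \<Longrightarrow> ([e], [l, r]) \<in> cells P \<Longrightarrow> edge_interval P r ((a + b) / 2) b"

definition represents :: "diagram \<Rightarrow> (real \<Rightarrow> real) \<Rightarrow> bool" where
  "represents D g \<longleftrightarrow>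
     (\<exists>P N. is_diagram P \<and> is_diagram N \<and> multipliable P N \<and> D = dmult P N \<and>
        longest_positive_path D (bot_path P) \<and>
        (\<forall>c\<in>cells P. pi_cell c) \<and> (\<forall>c\<in>cells N. pi_inv_cell c) \<and>
        (\<forall>e\<in>set (bot_path P). \<exists>a b c d.
           edge_interval P e a b \<and> edge_interval (dinv N) e c d \<and>
           (\<forall>x\<in>{a..b}. g x = c + (d - c) / (b - a) * (x - a)))) \<and>
     (\<forall>x. x \<notin> {0..1} \<longrightarrow> g x = x)"


section \<open>The Thompson graph and Jones' subgroup\<close>

definition directly_above :: "diagram \<Rightarrow> nat \<Rightarrow> nat \<Rightarrow> bool" where
  "directly_above D e f \<longleftrightarrow> (\<exists>c\<in>cells D. e \<in> set (fst c) \<and> f \<in> set (snd c))"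

definition in_edges :: "diagram \<Rightarrow> nat \<Rightarrow> nat set" where
  "in_edges D v = {e \<in> arcs (graph D). head (graph D) e = v}"

definition topmost_in :: "diagram \<Rightarrow> nat \<Rightarrow> nat \<Rightarrow> bool" where
  "topmost_in D v e \<longleftrightarrow> e \<in> in_edges D v \<and> (\<forall>f\<in>in_edges D v. (directly_above D)\<^sup>*\<^sup>* e f)"

definition botmost_in :: "diagram \<Rightarrow> nat \<Rightarrow> nat \<Rightarrow> bool" where
  "botmost_in D v e \<longleftrightarrow> e \<in> in_edges D v \<and> (\<forall>f\<in>in_edges D v. (directly_above D)\<^sup>*\<^sup>* f e)"

text \<open>The tags keep the upper and the lower edge of a vertex distinct when they come from the
  same edge of the diagram.  The arcs inherit a direction, which plays no role below.\<close>

datatype side = Upper | Lower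

definition thompson_graph :: "diagram \<Rightarrow> (nat, nat \<times> side) pre_digraph" where
  "thompson_graph D =
     \<lparr>verts = verts (graph D) - {term_vertex D},
      arcs = {(e, Upper) | e v. v \<in> inner_verts D \<and> topmost_in D v e} \<union>
             {(e, Lower) | e v. v \<in> inner_verts D \<and> botmost_in D v e},
      tail = (\<lambda>(e, s). tail (graph D) e),
      head = (\<lambda>(e, s). head (graph D) e)\<rparr>"

definition bipartite :: "('a, 'b) pre_digraph \<Rightarrow> bool" where
  "bipartite G \<longleftrightarrow>
     (\<exists>A B. A \<union> B = verts G \<and> A \<inter> B = {} \<and>
        (\<forall>e\<in>arcs G. tail G e \<in> A \<and> head G e \<in> B \<or> tail G e \<in> B \<and> head G e \<in> A))"

definition jones_subgroup :: "(real \<Rightarrow> real) set" where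
  "jones_subgroup =
     {g. \<exists>D. diagram_in_F D \<and> reduced D \<and> bipartite (thompson_graph D) \<and> represents D g}"

end

theory Submission
  imports Defs
begin

text \<open>
  Cut a diagram of an element \<open>g\<close> of \<open>F\<close> by its longest positive path into \<open>P\<close> above and the
  mirror image of \<open>Q\<close> below.  Both \<open>P\<close> and \<open>Q\<close> consist of cells \<open>\<pi>\<close> only, so each is a binary tree
  of carets, and all vertices lie on the common bottom path.  Give a vertex \<open>v\<close> the position \<open>x v\<close>
  that it has in the top subdivision and the position \<open>y v\<close> that it has in the bottom subdivision;
  then \<open>g (x v) = y v\<close>, and \<open>g\<close> is affine between consecutive positions.

  Every inner vertex \<open>v\<close> is the middle vertex of exactly one cell of \<open>P\<close>.  The left bottom edge \<open>l\<close>
  of this cell is the top-most edge that enters \<open>v\<close> (lemma \<open>topmost_glue\<close>), so the upper edge of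
  \<open>v\<close> in the Thompson graph is \<open>l\<close>.  The cell halves a standard dyadic interval
  \<open>[j / 2^k, (j + 1) / 2^k]\<close>, and \<open>l\<close> joins the left end of that interval to its midpoint, which has
  one binary digit 1 more.  Hence the parity of the digit sum of \<open>x\<close> changes along every upper edge.
  The upper edges alone connect all vertices, so up to exchanging the two colours this parity is
  the only 2-colouring of the upper edges (lemma \<open>two_colouring_is_parity\<close>).  Reflection
  exchanges upper and lower edges, so the parity of the digit sum of \<open>y\<close> is the only 2-colouring of
  the lower edges.  Both colourings agree at the initial vertex, where both positions are 0;
  therefore the Thompson graph is bipartite if and only if \<open>x v\<close> and \<open>y v\<close> have digit sums of equal
  parity for every \<open>v\<close> (lemma \<open>bipartite_thompson_graph_iff\<close>).

  Where \<open>g\<close> maps a standard interval affinely onto a standard interval, it replaces the digits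
  of the left end and keeps all further digits.  So \<open>g\<close> preserves the parity of the digit sum of every
  dyadic fraction in the interval as soon as it does so at the left end (lemma
  \<open>affine_piece_preserves_parity\<close>).  The condition on the positions thus says that \<open>g\<close> stabilizes
  the set of dyadic fractions with odd digit sum (lemma \<open>bipartite_iff_stabilizer\<close>).

  This shows that Jones' subgroup lies in the stabilizer.  For the converse every element of \<open>F\<close>
  needs a reduced diagram.  A sufficiently fine subdivision gives a pair of trees whose leaf intervals
  correspond under \<open>g\<close> (lemma \<open>thompson_F_tree_pair\<close>); removing common carets as long as possible
  makes the diagram of the pair reduced (lemma \<open>reduced_tree_pair_exists\<close>).
\<close>

section \<open>Digit sums\<close>

fun odd_ones :: "nat \<Rightarrow> bool" where
  "odd_ones n = (if n = 0 then False else odd n \<noteq> odd_ones (n div 2))"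

declare odd_ones.simps [simp del]

lemma odd_ones_0 [simp]: "\<not> odd_ones 0"
  by (simp add: odd_ones.simps)

lemma odd_ones_Suc_0 [simp]: "odd_ones (Suc 0)"
  by (simp add: odd_ones.simps[of "Suc 0"])

lemma odd_ones_double [simp]: "odd_ones (2 * n) = odd_ones n"
  by (simp add: odd_ones.simps[of "2 * n"])

lemma odd_ones_double_Suc: "odd_ones (Suc (2 * n)) = (\<not> odd_ones n)"
  by (simp add: odd_ones.simps[of "Suc (2 * n)"])

lemma odd_ones_shift [simp]: "odd_ones (n * 2 ^ k) = odd_ones n"
proof (induction k)
  case (Suc k)
  then show ?case using odd_ones_double[of "n * 2 ^ k"] by (simp add: ac_simps)
qed simp

text \<open>Multiplying \<open>j\<close> by \<open>2 ^ r\<close> and adding \<open>i < 2 ^ r\<close> writes the digits of \<open>i\<close> behind those of \<open>j\<close>.\<close>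
lemma odd_ones_concat:
  "i < 2 ^ r \<Longrightarrow> odd_ones (j * 2 ^ r + i) = (odd_ones j \<noteq> odd_ones i)"
proof (induction r arbitrary: i)
  case (Suc r)
  have i2: "i div 2 < 2 ^ r" using Suc.prems by auto
  have IH: "odd_ones (j * 2 ^ r + i div 2) = (odd_ones j \<noteq> odd_ones (i div 2))"
    by (rule Suc.IH[OF i2])
  show ?case
  proof (cases "even i")
    case True
    then obtain h where h: "i = 2 * h" by blast
    have "j * 2 ^ Suc r + i = 2 * (j * 2 ^ r + h)" by (simp add: h algebra_simps)
    then show ?thesis using IH by (simp only: odd_ones_double) (simp add: h)
  next
    case False
    then obtain h where h: "i = Suc (2 * h)" by (metis oddE Suc_eq_plus1)
    have "j * 2 ^ Suc r + i = Suc (2 * (j * 2 ^ r + h))" by (simp add: h algebra_simps)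
    then show ?thesis using IH by (simp only: odd_ones_double_Suc h) simp
  qed
qed simp

text \<open>The sum is the natural number with the digits \<open>d 0, \<dots>, d n\<close>, the last one being the lowest.
  Together with \<open>digits_exist\<close> this turns the expansions in the definition of
  \<^const>\<open>odd_digit_sum_dyadics\<close> into numerators.\<close>
lemma odd_ones_digits:
  "(\<forall>i\<le>n. d i \<in> {0, 1}) \<Longrightarrow> odd_ones (\<Sum>i\<le>n. d i * 2 ^ (n - i)) = odd (\<Sum>i\<le>n. d i)"
proof (induction n)
  case (Suc n)
  have eq: "(\<Sum>i\<le>Suc n. d i * 2 ^ (Suc n - i)) = 2 * (\<Sum>i\<le>n. d i * 2 ^ (n - i)) + d (Suc n)"
    by (simp add: sum_distrib_left Suc_diff_le algebra_simps)
  define X where "X = (\<Sum>i\<le>n. d i * 2 ^ (n - i))"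
  have IH: "odd_ones X = odd (\<Sum>i\<le>n. d i)" using Suc by (simp add: X_def)
  have "d (Suc n) = 0 \<or> d (Suc n) = Suc 0" using Suc.prems by auto
  then show ?case unfolding eq X_def[symmetric] by (auto simp: IH odd_ones_double_Suc)
qed auto

lemma digits_exist:
  "j < 2 ^ Suc k \<Longrightarrow> \<exists>d. (\<forall>i\<le>k. d i \<in> {0, 1}) \<and> (\<Sum>i\<le>k. d i * 2 ^ (k - i)) = (j::nat)"
proof (induction k arbitrary: j)
  case 0
  then show ?case by (intro exI[of _ "\<lambda>_. j"]) auto
next
  case (Suc k)
  have "j div 2 < 2 ^ Suc k" using Suc.prems by auto
  from Suc.IH[OF this] obtain d where d: "\<forall>i\<le>k. d i \<in> {0, 1}" "(\<Sum>i\<le>k. d i * 2 ^ (k - i)) = j div 2"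
    by blast
  let ?d = "d (Suc k := j mod 2)"
  have "(\<Sum>i\<le>Suc k. ?d i * 2 ^ (Suc k - i)) = 2 * (\<Sum>i\<le>k. d i * 2 ^ (k - i)) + j mod 2"
    by (simp add: sum_distrib_left Suc_diff_le algebra_simps)
  also have "\<dots> = j" by (simp add: d(2))
  finally have "(\<Sum>i\<le>Suc k. ?d i * 2 ^ (Suc k - i)) = j" .
  moreover have "\<forall>i\<le>Suc k. ?d i \<in> {0, 1}" using d(1) by (auto simp: le_Suc_eq)
  ultimately show ?case by blast
qed

lemma binary_expansion_iff:
  "binary_expansion n d x \<longleftrightarrow>
     (\<forall>i\<le>n. d i \<in> {0, 1}) \<and> x = real (\<Sum>i\<le>n. d i * 2 ^ (n - i)) / 2 ^ n"
proof -
  have "(2::real) ^ (n - i) / 2 ^ n = 1 / 2 ^ i" if "i \<le> n" for i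
    using that by (simp add: power_diff)
  then have "(\<Sum>i\<le>n. real (d i) / 2 ^ i) = (\<Sum>i\<le>n. real (d i * 2 ^ (n - i)) / 2 ^ n)"
    by (intro sum.cong refl) (simp add: field_simps)
  also have "\<dots> = real (\<Sum>i\<le>n. d i * 2 ^ (n - i)) / 2 ^ n"
    by (simp add: sum_divide_distrib)
  finally show ?thesis by (simp add: binary_expansion_def)
qed

text \<open>Membership depends on the numerator over any power of two: two fractions \<open>j / 2 ^ k\<close> and
  \<open>J / 2 ^ n\<close> with the same value have numerators that differ only by appended digits 0.\<close>
lemma dyadic_odd_iff:
  assumes "j \<le> 2 ^ k"
  shows "real j / 2 ^ k \<in> odd_digit_sum_dyadics \<longleftrightarrow> odd_ones j"
proof
  assume "real j / 2 ^ k \<in> odd_digit_sum_dyadics"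
  then obtain n d where nd: "binary_expansion n d (real j / 2 ^ k)" "odd (\<Sum>i\<le>n. d i)"
    unfolding odd_digit_sum_dyadics_def by blast
  define J where "J = (\<Sum>i\<le>n. d i * 2 ^ (n - i))"
  have "odd_ones J" and eq: "real j / 2 ^ k = real J / 2 ^ n"
    using nd odd_ones_digits[of n d] by (auto simp: binary_expansion_iff J_def)
  from eq have "real j * 2 ^ n = real J * 2 ^ k" by (simp add: field_simps)
  then have "real (j * 2 ^ n) = real (J * 2 ^ k)" by simp
  then have "j * 2 ^ n = J * 2 ^ k" by (simp only: of_nat_eq_iff)
  then show "odd_ones j" using \<open>odd_ones J\<close> by (metis odd_ones_shift)
next
  assume odd: "odd_ones j"
  have "(2::nat) ^ k < 2 ^ Suc k" by simp
  with assms have "j < 2 ^ Suc k" by linarith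
  then obtain d where d: "\<forall>i\<le>k. d i \<in> {0, 1}" "(\<Sum>i\<le>k. d i * 2 ^ (k - i)) = j"
    using digits_exist by blast
  have "real j \<le> real (2 ^ k)" using assms by (simp only: of_nat_le_iff)
  then have "real j / 2 ^ k \<in> {0..1}" by simp
  moreover have "binary_expansion k d (real j / 2 ^ k)" using d by (simp add: binary_expansion_iff)
  moreover have "odd (\<Sum>i\<le>k. d i)" using odd_ones_digits[of k d] d odd by simp
  ultimately show "real j / 2 ^ k \<in> odd_digit_sum_dyadics"
    unfolding odd_digit_sum_dyadics_def by blast
qed

lemma odd_digit_sum_dyadicsE:
  assumes "x \<in> odd_digit_sum_dyadics"
  obtains j k where "j \<le> 2 ^ k" "x = real j / 2 ^ k"
proof -
  from assms obtain n d where "x \<in> {0..1}" "binary_expansion n d x"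
    unfolding odd_digit_sum_dyadics_def by blast
  then have "x = real (\<Sum>i\<le>n. d i * 2 ^ (n - i)) / 2 ^ n" "x \<le> 1"
    by (auto simp only: binary_expansion_iff atLeastAtMost_iff)
  then obtain j where "x = real j / 2 ^ n" "x \<le> 1" by blast
  moreover from this have "real j \<le> real (2 ^ n)" by simp
  then have "j \<le> 2 ^ n" by (simp only: of_nat_le_iff)
  ultimately show thesis using that by blast
qed

lemma odd_digit_sum_dyadics_subset: "odd_digit_sum_dyadics \<subseteq> {0..1}"
  by (auto simp: odd_digit_sum_dyadics_def)

lemma zero_not_odd: "0 \<notin> odd_digit_sum_dyadics"
  using dyadic_odd_iff[of 0 0] by simp

definition standard_interval :: "real \<Rightarrow> real \<Rightarrow> bool" where
  "standard_interval a b \<longleftrightarrow>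
     (\<exists>j k. j < 2 ^ k \<and> a = real j / 2 ^ k \<and> b = real (Suc j) / 2 ^ k)"

lemma standard_interval_unit: "standard_interval 0 1"
  unfolding standard_interval_def by (rule exI[of _ 0], rule exI[of _ 0]) simp

lemma standard_interval_halves:
  assumes "standard_interval a b"
  shows "standard_interval a ((a + b) / 2)" "standard_interval ((a + b) / 2) b"
proof -
  from assms obtain j k where jk: "j < 2 ^ k" "a = real j / 2 ^ k" "b = real (Suc j) / 2 ^ k"
    unfolding standard_interval_def by blast
  have "a = real (2 * j) / 2 ^ Suc k" "(a + b) / 2 = real (Suc (2 * j)) / 2 ^ Suc k"
    "b = real (Suc (Suc (2 * j))) / 2 ^ Suc k" "2 * j < 2 ^ Suc k" "Suc (2 * j) < 2 ^ Suc k"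
    using jk by (simp_all add: field_simps)
  then show "standard_interval a ((a + b) / 2)" "standard_interval ((a + b) / 2) b"
    unfolding standard_interval_def by blast+
qed

lemma standard_interval_bounds:
  assumes "standard_interval a b"
  shows "0 \<le> a" "a < b" "b \<le> 1" "a \<in> dyadic" "b \<in> dyadic"
proof -
  from assms obtain j k where jk: "j < 2 ^ k" "a = real j / 2 ^ k" "b = real (Suc j) / 2 ^ k"
    unfolding standard_interval_def by blast
  have "real (Suc j) \<le> real (2 ^ k)" using jk(1) by (simp only: of_nat_le_iff Suc_le_eq)
  then show "0 \<le> a" "a < b" "b \<le> 1" using jk by (simp_all add: divide_strict_right_mono)
  show "a \<in> dyadic" "b \<in> dyadic" unfolding dyadic_def jk
    by (metis (mono_tags, lifting) mem_Collect_eq of_int_of_nat_eq)+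
qed

text \<open>The midpoint of \<open>[j / 2 ^ k, (j + 1) / 2 ^ k]\<close> is \<open>(2 * j + 1) / 2 ^ (k + 1)\<close>: its numerator
  is that of the left end with a digit 1 appended.  This is the source of the 2-colouring.\<close>
lemma midpoint_flips_parity:
  assumes "standard_interval a b"
  shows "(a + b) / 2 \<in> odd_digit_sum_dyadics \<longleftrightarrow> a \<notin> odd_digit_sum_dyadics"
proof -
  from assms obtain j k where jk: "j < 2 ^ k" "a = real j / 2 ^ k" "b = real (Suc j) / 2 ^ k"
    unfolding standard_interval_def by blast
  have m: "(a + b) / 2 = real (Suc (2 * j)) / 2 ^ Suc k" using jk by (simp add: field_simps)
  have "Suc (2 * j) \<le> 2 ^ Suc k" using jk(1) by simp
  then show ?thesis using dyadic_odd_iff[of "Suc (2 * j)" "Suc k"] dyadic_odd_iff[of j k] jk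
    unfolding m by (simp add: odd_ones_double_Suc)
qed

definition affine_piece :: "(real \<Rightarrow> real) \<Rightarrow> real \<Rightarrow> real \<Rightarrow> real \<Rightarrow> real \<Rightarrow> bool" where
  "affine_piece g a b c d \<longleftrightarrow> (\<forall>x\<in>{a..b}. g x = c + (d - c) / (b - a) * (x - a))"

lemma affine_piece_ends:
  assumes "affine_piece g a b c d" "a < b"
  shows "g a = c" "g b = d"
  using assms by (auto simp: affine_piece_def)

lemma affine_piece_mono:
  assumes "affine_piece g a b c d" "a < b" "c < d" "x \<in> {a..b}" "y \<in> {a..b}" "x < y"
  shows "g x < g y"
proof -
  have "(d - c) / (b - a) > 0" using assms by simp
  then have "(d - c) / (b - a) * (x - a) < (d - c) / (b - a) * (y - a)"
    using assms(6) by (intro mult_strict_left_mono) auto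
  moreover have "g x = c + (d - c) / (b - a) * (x - a)" "g y = c + (d - c) / (b - a) * (y - a)"
    using assms(1,4,5) unfolding affine_piece_def by blast+
  ultimately show ?thesis by linarith
qed

lemma affine_piece_inverse:
  assumes "affine_piece g a b c d" "a < b" "c < d" "x \<in> {a..b}"
  shows "x = a + (b - a) / (d - c) * (g x - c)"
proof -
  have gx: "g x = c + (d - c) / (b - a) * (x - a)" using assms(1,4) unfolding affine_piece_def by blast
  show ?thesis unfolding gx using assms(2,3) by simp
qed

text \<open>Over a common denominator, \<open>x\<close> has the numerator \<open>j * 2 ^ n + i\<close> and its image \<open>y\<close> the numerator
  \<open>j' * 2 ^ n + i\<close> with the same \<open>i\<close>, where \<open>j\<close> and \<open>j'\<close> are the numerators of the left ends.\<close>
lemma affine_standard_dyadic: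
  assumes "standard_interval a b" "standard_interval c d"
    and x: "x = real m / 2 ^ n" "a \<le> x" "x < b"
    and y: "y = c + (d - c) / (b - a) * (x - a)"
    and ac: "a \<in> odd_digit_sum_dyadics \<longleftrightarrow> c \<in> odd_digit_sum_dyadics"
  shows "x \<in> odd_digit_sum_dyadics \<longleftrightarrow> y \<in> odd_digit_sum_dyadics"
proof -
  obtain j k where jk: "j < 2 ^ k" "a = real j / 2 ^ k" "b = real (Suc j) / 2 ^ k"
    using assms(1) unfolding standard_interval_def by blast
  obtain j' k' where jk': "j' < 2 ^ k'" "c = real j' / 2 ^ k'" "d = real (Suc j') / 2 ^ k'"
    using assms(2) unfolding standard_interval_def by blast
  have ba: "b - a = 1 / 2 ^ k" and dc: "d - c = 1 / 2 ^ k'" by (simp_all add: jk jk' field_simps)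
  have "real j * 2 ^ n \<le> real m * 2 ^ k" "real m * 2 ^ k < real (Suc j) * 2 ^ n"
    using x(2,3) unfolding x(1) jk by (simp_all add: field_simps)
  then have "real (j * 2 ^ n) \<le> real (m * 2 ^ k)" "real (m * 2 ^ k) < real (Suc j * 2 ^ n)"
    by (simp_all add: algebra_simps)
  then have le: "j * 2 ^ n \<le> m * 2 ^ k" and lt: "m * 2 ^ k < Suc j * 2 ^ n"
    by (simp_all only: of_nat_le_iff of_nat_less_iff)
  define i where "i = m * 2 ^ k - j * 2 ^ n"
  have mi: "m * 2 ^ k = j * 2 ^ n + i" using le by (simp add: i_def)
  then have i: "i < 2 ^ n" using lt by simp
  have "x = real (m * 2 ^ k) / 2 ^ (n + k)" by (simp add: x(1) power_add)
  then have x': "x = real (j * 2 ^ n + i) / 2 ^ (n + k)" unfolding mi .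
  have y': "y = real (j' * 2 ^ n + i) / 2 ^ (n + k')"
    unfolding y ba dc unfolding x' jk(2) jk'(2) by (simp add: field_simps power_add)
  have bd: "j * 2 ^ n + i \<le> 2 ^ (n + k)" if "j < 2 ^ k" for j k :: nat
  proof -
    have "Suc j * 2 ^ n \<le> 2 ^ k * 2 ^ n" using that by (intro mult_right_mono) auto
    then show ?thesis using i by (simp add: power_add ac_simps)
  qed
  have "x \<in> odd_digit_sum_dyadics \<longleftrightarrow> odd_ones (j * 2 ^ n + i)"
    unfolding x' by (rule dyadic_odd_iff[OF bd[OF jk(1)]])
  moreover have "y \<in> odd_digit_sum_dyadics \<longleftrightarrow> odd_ones (j' * 2 ^ n + i)"
    unfolding y' by (rule dyadic_odd_iff[OF bd[OF jk'(1)]])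
  moreover have "odd_ones j = odd_ones j'"
    using ac dyadic_odd_iff[of j k] dyadic_odd_iff[of j' k'] jk jk' by auto
  ultimately show ?thesis using i by (simp add: odd_ones_concat)
qed

text \<open>The preceding lemma speaks of a dyadic \<open>x\<close>.  If only \<open>g x\<close> is known to be dyadic, it is applied
  to the inverse of the affine map.\<close>
lemma affine_piece_preserves_parity:
  assumes ab: "standard_interval a b" and cd: "standard_interval c d" and g: "affine_piece g a b c d"
    and ac: "a \<in> odd_digit_sum_dyadics \<longleftrightarrow> c \<in> odd_digit_sum_dyadics"
    and x: "a \<le> x" "x < b"
  shows "x \<in> odd_digit_sum_dyadics \<longleftrightarrow> g x \<in> odd_digit_sum_dyadics"
proof -
  note b = standard_interval_bounds[OF ab] and d = standard_interval_bounds[OF cd]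
  have gx: "g x = c + (d - c) / (b - a) * (x - a)" using g x by (auto simp: affine_piece_def)
  have inv: "x = a + (b - a) / (d - c) * (g x - c)"
    using affine_piece_inverse[OF g b(2) d(2)] x by simp
  have gle: "c \<le> g x" "g x < d"
    using affine_piece_mono[OF g b(2) d(2), of a x] affine_piece_mono[OF g b(2) d(2), of x b]
      affine_piece_ends[OF g b(2)] x by (cases "a = x"; simp)+
  show ?thesis
  proof
    assume *: "x \<in> odd_digit_sum_dyadics"
    then obtain m n where "x = real m / 2 ^ n" by (rule odd_digit_sum_dyadicsE)
    from affine_standard_dyadic[OF ab cd this x gx ac] * show "g x \<in> odd_digit_sum_dyadics" by simp
  next
    assume *: "g x \<in> odd_digit_sum_dyadics"
    then obtain m n where "g x = real m / 2 ^ n" by (rule odd_digit_sum_dyadicsE)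
    from affine_standard_dyadic[OF cd ab this gle inv] ac * show "x \<in> odd_digit_sum_dyadics" by simp
  qed
qed

section \<open>Piecewise affine maps along dyadic subdivisions\<close>

text \<open>\<open>standard_chain g B a b c d\<close>: the points of \<open>B\<close>, from \<open>a\<close> to \<open>b\<close>, cut \<open>[a, b]\<close> into standard
  intervals, which \<open>g\<close> maps affinely, in order, onto standard intervals that fill \<open>[c, d]\<close>.\<close>
inductive standard_chain :: "(real \<Rightarrow> real) \<Rightarrow> real set \<Rightarrow> real \<Rightarrow> real \<Rightarrow> real \<Rightarrow> real \<Rightarrow> bool"
  for g where
  single: "standard_interval a b \<Longrightarrow> standard_interval c d \<Longrightarrow> affine_piece g a b c d \<Longrightarrow>
     standard_chain g {a, b} a b c d"
| cons: "standard_interval a m \<Longrightarrow> standard_interval c n \<Longrightarrow> affine_piece g a m c n \<Longrightarrow>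
     standard_chain g B m b n d \<Longrightarrow> standard_chain g (insert a B) a b c d"

lemma standard_chain_ends:
  assumes "standard_chain g B a b c d"
  shows "a < b \<and> c < d \<and> g a = c \<and> g b = d \<and> finite B \<and> B \<subseteq> dyadic \<inter> {a..b} \<and> {a, b} \<subseteq> B"
  using assms
proof induction
  case (single a b c d)
  then show ?case using standard_interval_bounds[of a b] standard_interval_bounds[of c d]
      affine_piece_ends[of g a b c d] by auto
next
  case (cons a m c n B b d)
  have "a < m" "c < n" "a \<in> dyadic" "m < b"
    using standard_interval_bounds[OF cons(1)] standard_interval_bounds[OF cons(2)] cons.IH by auto
  then show ?case using cons.IH affine_piece_ends[OF cons(3)] by auto
qed

lemma standard_chain_strict_mono:
  assumes "standard_chain g B a b c d"
  shows "strict_mono_on {a..b} g"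
  using assms
proof induction
  case (single a b c d)
  then show ?case using standard_interval_bounds[of a b] standard_interval_bounds[of c d]
      affine_piece_mono[of g a b c d] by (intro strict_mono_onI) auto
next
  case (cons a m c n B b d)
  have ends: "a < m" "c < n" "m < b" "g m = n"
    using standard_interval_bounds[OF cons(1)] standard_interval_bounds[OF cons(2)]
      standard_chain_ends[OF cons(4)] by auto
  show ?case
  proof (rule strict_mono_onI)
    fix x y assume xy: "x \<in> {a..b}" "y \<in> {a..b}" "x < y"
    have left: "g u < g v" if "u \<in> {a..m}" "v \<in> {a..m}" "u < v" for u v
      using affine_piece_mono[OF cons(3) ends(1,2)] that by blast
    have right: "g u < g v" if "u \<in> {m..b}" "v \<in> {m..b}" "u < v" for u v
      using cons.IH that by (rule strict_mono_onD)
    show "g x < g y"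
    proof (cases "y \<le> m \<or> m \<le> x")
      case True
      then show ?thesis using xy left right by force
    next
      case False
      then have "g x < g m" "g m < g y" using xy ends left right by auto
      then show ?thesis by simp
    qed
  qed
qed

lemma affine_piece_continuous:
  "affine_piece g a b c d \<Longrightarrow> continuous_on {a..b} g"
proof -
  assume "affine_piece g a b c d"
  then have eq: "g x = c + (d - c) / (b - a) * (x - a)" if "x \<in> {a..b}" for x
    using that unfolding affine_piece_def by blast
  have "continuous_on {a..b} (\<lambda>x. c + (d - c) / (b - a) * (x - a))"
    by (intro continuous_intros continuous_on_mult_left)
  then show ?thesis by (rule continuous_on_eq) (rule eq[symmetric])
qed

lemma standard_chain_continuous:
  assumes "standard_chain g B a b c d"
  shows "continuous_on {a..b} g"
  using assms
proof induction
  case (cons a m c n B b d)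
  have "a < m" "m < b"
    using standard_interval_bounds[OF cons(1)] standard_chain_ends[OF cons(4)] by auto
  then have "{a..b} = {a..m} \<union> {m..b}" by auto
  then show ?case using cons affine_piece_continuous by (auto intro!: continuous_on_closed_Un)
qed (rule affine_piece_continuous)

lemma standard_slope:
  assumes "standard_interval a b" "standard_interval c d"
  shows "\<exists>k::int. (d - c) / (b - a) = 2 powi k"
proof -
  obtain j k where jk: "a = real j / 2 ^ k" "b = real (Suc j) / 2 ^ k"
    using assms(1) unfolding standard_interval_def by blast
  obtain j' k' where jk': "c = real j' / 2 ^ k'" "d = real (Suc j') / 2 ^ k'"
    using assms(2) unfolding standard_interval_def by blast
  have "(d - c) / (b - a) = 2 ^ k / 2 ^ k'" by (simp add: jk jk' field_simps)
  also have "\<dots> = 2 powi (int k - int k')" by (simp add: power_int_diff)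
  finally show ?thesis by blast
qed

text \<open>An interval that contains no division point in its interior lies in a single piece; this
  gives the slope condition in the definition of \<^const>\<open>thompson_F\<close>, with \<open>B\<close> as set of breaks.\<close>
lemma standard_chain_affine_between:
  assumes "standard_chain g B a b c d" "a \<le> u" "u < v" "v \<le> b" "{u<..<v} \<inter> B = {}"
  shows "\<exists>(k::int) t. \<forall>x\<in>{u..v}. g x = 2 powi k * x + t"
  using assms
proof induction
  case (single a b c d)
  obtain k :: int where k: "(d - c) / (b - a) = 2 powi k" using standard_slope[OF single(1,2)] by blast
  have "\<forall>x\<in>{u..v}. g x = 2 powi k * x + (c - 2 powi k * a)"
    using single unfolding affine_piece_def k by (auto simp: algebra_simps)
  then show ?case by blast
next
  case (cons a m c n B b d)
  have "m \<in> B" using standard_chain_ends[OF cons(4)] by auto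
  then have "m \<notin> {u<..<v}" using cons.prems by blast
  then consider "v \<le> m" | "m \<le> u" by force
  then show ?case
  proof cases
    case 1
    obtain k :: int where k: "(n - c) / (m - a) = 2 powi k"
      using standard_slope[OF cons(1,2)] by blast
    have "\<forall>x\<in>{u..v}. g x = 2 powi k * x + (c - 2 powi k * a)"
      using cons.prems cons.hyps(3) 1 unfolding affine_piece_def k by (auto simp: algebra_simps)
    then show ?thesis by blast
  next
    case 2
    then show ?thesis using cons by blast
  qed
qed

text \<open>Each piece starts at a division point, so the parities at the division points decide all
  others.  The right end \<open>b\<close> belongs to no half-open piece.\<close>
lemma standard_chain_parity:
  assumes "standard_chain g B a b c d"
    and "\<And>p. p \<in> B \<Longrightarrow> p < b \<Longrightarrow> p \<in> odd_digit_sum_dyadics \<longleftrightarrow> g p \<in> odd_digit_sum_dyadics"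
    and "a \<le> x" "x < b"
  shows "x \<in> odd_digit_sum_dyadics \<longleftrightarrow> g x \<in> odd_digit_sum_dyadics"
  using assms
proof induction
  case (single a b c d)
  have "a < b" using standard_interval_bounds[OF single(1)] by simp
  then show ?case using affine_piece_preserves_parity[OF single(1-3)] single(4)[of a] single(5,6)
      affine_piece_ends[OF single(3)] by auto
next
  case (cons a m c n B b d)
  have am: "a < m" "m < b"
    using standard_interval_bounds[OF cons(1)] standard_chain_ends[OF cons(4)] by auto
  show ?case
  proof (cases "x < m")
    case True
    then show ?thesis using affine_piece_preserves_parity[OF cons(1-3)] cons.prems am
        affine_piece_ends[OF cons(3)] cons.prems(1)[of a] by auto
  next
    case False
    then show ?thesis using cons by auto
  qed
qed

lemma standard_chain_thompson_F:
  assumes "standard_chain g B 0 1 0 1" and "\<forall>x. x \<notin> {0..1} \<longrightarrow> g x = x"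
  shows "g \<in> thompson_F"
proof -
  note mono = standard_chain_strict_mono[OF assms(1)] and cont = standard_chain_continuous[OF assms(1)]
  have ends: "g 0 = 0" "g 1 = 1" "finite B" "B \<subseteq> dyadic"
    using standard_chain_ends[OF assms(1)] by auto
  have le: "g x \<le> g y" if "x \<in> {0..1}" "y \<in> {0..1}" "x \<le> y" for x y
    using strict_mono_onD[OF mono, of x y] that by (cases "x = y") auto
  have "g ` {0..1} = {0..1}"
  proof
    show "g ` {0..1} \<subseteq> {0..1}" using le[of 0] le[of _ 1] ends by force
    show "{0..1} \<subseteq> g ` {0..1}"
    proof
      fix y :: real assume "y \<in> {0..1}"
      then obtain x where "0 \<le> x" "x \<le> 1" "g x = y" using IVT'[of g 0 y 1] cont ends by auto
      then show "y \<in> g ` {0..1}" by auto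
    qed
  qed
  then obtain h where h: "homeomorphism {0..1} {0..1} g h"
    using homeomorphism_compact[OF _ cont _ strict_mono_on_imp_inj_on[OF mono]] by auto
  moreover have "\<forall>a b. 0 \<le> a \<and> a < b \<and> b \<le> 1 \<and> {a<..<b} \<inter> B = {} \<longrightarrow>
           (\<exists>(k::int) c. \<forall>x\<in>{a..b}. g x = 2 powi k * x + c)"
    using standard_chain_affine_between[OF assms(1)] by blast
  ultimately show ?thesis using mono ends assms(2) unfolding thompson_F_def by blast
qed

lemma thompson_F_image_unit: "g \<in> thompson_F \<Longrightarrow> g ` {0..1} = {0..1}"
  unfolding thompson_F_def homeomorphism_def by blast

lemma thompson_F_inj: "g \<in> thompson_F \<Longrightarrow> inj_on g {0..1}"
  unfolding thompson_F_def using strict_mono_on_imp_inj_on by blast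

lemma thompson_F_ends:
  assumes "g \<in> thompson_F" shows "g 0 = 0" "g 1 = 1"
proof -
  have mono: "strict_mono_on {0..1} g" using assms by (simp add: thompson_F_def)
  have img: "g ` {0..1} = {0..1}" using assms by (rule thompson_F_image_unit)
  have "0 \<in> g ` {0..1}" "1 \<in> g ` {0..1}" by (simp_all add: img)
  then obtain x y where xy: "x \<in> {0..1}" "g x = 0" "y \<in> {0..1}" "g y = 1" by (metis imageE)
  have "g 0 \<in> {0..1}" "g 1 \<in> {0..1}" using img by (metis atLeastAtMost_iff imageI order_refl zero_le_one)+
  then show "g 0 = 0" "g 1 = 1"
    using strict_mono_onD[OF mono, of 0 x] strict_mono_onD[OF mono, of y 1] xy
    by (cases "x = 0"; cases "y = 1"; force)+
qed

lemma stabilizer_F_iff: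
  assumes "S \<subseteq> {0..1}"
  shows "g \<in> stabilizer_F S \<longleftrightarrow> g \<in> thompson_F \<and> (\<forall>x\<in>{0..1}. x \<in> S \<longleftrightarrow> g x \<in> S)"
proof
  assume "g \<in> stabilizer_F S"
  then have F: "g \<in> thompson_F" and img: "g ` S = S" by (simp_all add: stabilizer_F_def)
  have "x \<in> S \<longleftrightarrow> g x \<in> S" if "x \<in> {0..1}" for x
    using inj_on_image_mem_iff[OF thompson_F_inj[OF F] that assms] img by simp
  with F show "g \<in> thompson_F \<and> (\<forall>x\<in>{0..1}. x \<in> S \<longleftrightarrow> g x \<in> S)" by blast
next
  assume "g \<in> thompson_F \<and> (\<forall>x\<in>{0..1}. x \<in> S \<longleftrightarrow> g x \<in> S)"
  then have F: "g \<in> thompson_F" and par: "\<forall>x\<in>{0..1}. x \<in> S \<longleftrightarrow> g x \<in> S" by auto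
  have "g ` S = S"
  proof
    show "g ` S \<subseteq> S" using par assms by blast
    show "S \<subseteq> g ` S"
    proof
      fix y assume "y \<in> S"
      then obtain x where "x \<in> {0..1}" "y = g x" using thompson_F_image_unit[OF F] assms by blast
      then show "y \<in> g ` S" using par \<open>y \<in> S\<close> by blast
    qed
  qed
  then show "g \<in> stabilizer_F S" using F by (simp add: stabilizer_F_def)
qed

lemma standard_chain_stabilizer_iff:
  assumes chain: "standard_chain g B 0 1 0 1" and "\<forall>x. x \<notin> {0..1} \<longrightarrow> g x = x"
  shows "g \<in> stabilizer_F odd_digit_sum_dyadics \<longleftrightarrow>
    (\<forall>p\<in>B. p \<in> odd_digit_sum_dyadics \<longleftrightarrow> g p \<in> odd_digit_sum_dyadics)" (is "_ \<longleftrightarrow> ?par")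
proof -
  have F: "g \<in> thompson_F" using assms by (rule standard_chain_thompson_F)
  have "?par \<longleftrightarrow> (\<forall>x\<in>{0..1}. x \<in> odd_digit_sum_dyadics \<longleftrightarrow> g x \<in> odd_digit_sum_dyadics)"
  proof
    assume par: ?par
    have "x \<in> odd_digit_sum_dyadics \<longleftrightarrow> g x \<in> odd_digit_sum_dyadics" if "0 \<le> x" "x < 1" for x
      using standard_chain_parity[OF chain] par that by blast
    moreover have "g 1 = 1" using thompson_F_ends[OF F] by simp
    ultimately show "\<forall>x\<in>{0..1}. x \<in> odd_digit_sum_dyadics \<longleftrightarrow> g x \<in> odd_digit_sum_dyadics"
      by (metis atLeastAtMost_iff order_le_less)
  next
    assume "\<forall>x\<in>{0..1}. x \<in> odd_digit_sum_dyadics \<longleftrightarrow> g x \<in> odd_digit_sum_dyadics"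
    then show ?par using standard_chain_ends[OF chain] by blast
  qed
  then show ?thesis using F stabilizer_F_iff[OF odd_digit_sum_dyadics_subset] by simp
qed

section \<open>Diagrams all of whose cells are positive\<close>

lemma dadd_simps [simp]:
  "verts (graph (dadd D E)) = verts (graph D) \<union> verts (graph E)"
  "arcs (graph (dadd D E)) = arcs (graph D) \<union> arcs (graph E)"
  "tail (graph (dadd D E)) = tail (graph D)" "head (graph (dadd D E)) = head (graph D)"
  "top_path (dadd D E) = top_path D @ top_path E" "bot_path (dadd D E) = bot_path D @ bot_path E"
  "cells (dadd D E) = cells D \<union> cells E"
  by (simp_all add: dadd_def union_def)

lemma dmult_simps [simp]:
  "verts (graph (dmult D E)) = verts (graph D) \<union> verts (graph E)"
  "arcs (graph (dmult D E)) = arcs (graph D) \<union> arcs (graph E)"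
  "tail (graph (dmult D E)) = tail (graph D)" "head (graph (dmult D E)) = head (graph D)"
  "top_path (dmult D E) = top_path D" "bot_path (dmult D E) = bot_path E"
  "cells (dmult D E) = cells D \<union> cells E"
  by (simp_all add: dmult_def union_def)

lemma dinv_simps [simp]:
  "graph (dinv D) = graph D" "top_path (dinv D) = bot_path D" "bot_path (dinv D) = top_path D"
  "cells (dinv D) = prod.swap ` cells D"
  by (simp_all add: dinv_def)

lemma dinv_dinv [simp]: "dinv (dinv D) = D"
  by (simp add: dinv_def image_image)

lemma dinv_dadd: "dinv (dadd D E) = dadd (dinv D) (dinv E)"
  by (simp add: dinv_def dadd_def image_Un)

lemma dinv_dmult: "compatible (graph D) (graph E) \<Longrightarrow> dinv (dmult D E) = dmult (dinv E) (dinv D)"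
  by (simp add: dinv_def dmult_def image_Un union_def compatible_def Un_commute)

text \<open>For the nonempty top and bottom paths, this set is that of the vertices visited by the walk.
  Unlike \<^const>\<open>pre_digraph.awalk_verts\<close> it needs no start vertex, so it can be compared between
  diagrams that share the path.\<close>
definition path_verts :: "diagram \<Rightarrow> nat list \<Rightarrow> nat set" where
  "path_verts D p = insert (tail (graph D) (hd p)) (head (graph D) ` set p)"

lemma cas_append:
  "pre_digraph.cas G u p w \<Longrightarrow> pre_digraph.cas G w q v \<Longrightarrow> pre_digraph.cas G u (p @ q) v"
  by (induction p arbitrary: u) (simp_all add: pre_digraph.cas.simps)

lemma cas_verts:
  "pre_digraph.cas G u p v \<Longrightarrow> set (pre_digraph.awalk_verts G u p) = insert u (head G ` set p)"
  by (induction p arbitrary: u) (auto simp: pre_digraph.cas.simps pre_digraph.awalk_verts.simps)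

lemma cas_head_last: "pre_digraph.cas G u p v \<Longrightarrow> p \<noteq> [] \<Longrightarrow> head G (last p) = v"
  by (induction p arbitrary: u) (auto simp: pre_digraph.cas.simps split: if_splits)

lemma cas_tail_hd: "pre_digraph.cas G u p v \<Longrightarrow> p \<noteq> [] \<Longrightarrow> tail G (hd p) = u"
  by (cases p) (auto simp: pre_digraph.cas.simps)

text \<open>The incidence facts that addition, multiplication and inversion preserve.  In particular the
  top and the bottom path share both ends, which makes \<^const>\<open>init_vertex\<close> and \<^const>\<open>term_vertex\<close>
  invariant under inversion.\<close>
definition well_formed :: "diagram \<Rightarrow> bool" where
  "well_formed D \<longleftrightarrow>
     (\<forall>p\<in>{top_path D, bot_path D}. p \<noteq> [] \<and> set p \<subseteq> arcs (graph D) \<and>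
        pre_digraph.cas (graph D) (init_vertex D) p (term_vertex D)) \<and>
     (\<forall>e\<in>arcs (graph D). tail (graph D) e \<in> verts (graph D) \<and> head (graph D) e \<in> verts (graph D)) \<and>
     (\<forall>c\<in>cells D. set (fst c) \<subseteq> arcs (graph D) \<and> set (snd c) \<subseteq> arcs (graph D))"

lemma well_formed_dinv_ends:
  assumes "well_formed D"
  shows "init_vertex (dinv D) = init_vertex D" "term_vertex (dinv D) = term_vertex D"
  using assms cas_tail_hd[of "graph D" "init_vertex D" "bot_path D"]
    cas_head_last[of "graph D" "init_vertex D" "bot_path D"]
  by (auto simp: well_formed_def init_vertex_def term_vertex_def)

lemma dadd_ends:
  assumes "well_formed D" "well_formed E" "addable D E"
  shows "init_vertex (dadd D E) = init_vertex D" "term_vertex (dadd D E) = term_vertex E"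
  using assms by (auto simp: well_formed_def init_vertex_def term_vertex_def addable_def compatible_def)

lemma dmult_ends:
  assumes "well_formed D" "well_formed E" "multipliable D E"
  shows "init_vertex (dmult D E) = init_vertex D" "term_vertex (dmult D E) = term_vertex D"
    "init_vertex E = init_vertex D" "term_vertex E = term_vertex D"
  using assms well_formed_dinv_ends[OF assms(1)]
  by (auto simp: init_vertex_def term_vertex_def multipliable_def compatible_def)

lemma is_diagram_well_formed: "is_diagram D \<Longrightarrow> well_formed D"
proof (induction rule: is_diagram.induct)
  case (edge D)
  then show ?case
    by (auto simp: edge_diagram_def well_formed_def init_vertex_def term_vertex_def pre_digraph.cas.simps)
next
  case (cell D)
  then show ?case
    by (auto simp: pi_diagram_def well_formed_def init_vertex_def term_vertex_def pre_digraph.cas.simps)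
next
  case (add D E)
  have c: "pre_digraph.cas (graph (dadd D E)) = pre_digraph.cas (graph D)"
    "pre_digraph.cas (graph E) = pre_digraph.cas (graph D)"
    using add(3) by (auto intro!: compatible_cas simp: compatible_def addable_def)
  have "term_vertex D = init_vertex E" using add(3) by (simp add: addable_def)
  then have "pre_digraph.cas (graph D) (init_vertex D) (top_path D @ top_path E) (term_vertex E)"
    "pre_digraph.cas (graph D) (init_vertex D) (bot_path D @ bot_path E) (term_vertex E)"
    using add.IH c(2) by (auto intro!: cas_append simp: well_formed_def)
  then show ?case using add.IH add(3)
    unfolding well_formed_def[of "dadd D E"] dadd_ends[OF add.IH add(3)] c
    by (auto simp: well_formed_def addable_def compatible_def)
next
  case (mult D E)
  have c: "pre_digraph.cas (graph (dmult D E)) = pre_digraph.cas (graph D)"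
    "pre_digraph.cas (graph E) = pre_digraph.cas (graph D)"
    using mult(3) by (auto intro!: compatible_cas simp: compatible_def multipliable_def)
  show ?case using mult.IH mult(3)
    unfolding well_formed_def[of "dmult D E"] dmult_ends[OF mult.IH mult(3)] c
    using dmult_ends[OF mult.IH mult(3)] c
    by (auto simp: well_formed_def multipliable_def compatible_def)
next
  case (inv D)
  then show ?case unfolding well_formed_def[of "dinv D"] well_formed_dinv_ends[OF inv.IH]
    by (auto simp: well_formed_def)
qed

lemma path_verts_walk:
  assumes "well_formed D"
  shows "p \<in> {top_path D, bot_path D} \<Longrightarrow>
      set (pre_digraph.awalk_verts (graph D) (init_vertex D) p) = path_verts D p"
    "p \<in> {top_path D, bot_path D} \<Longrightarrow> path_verts D p \<subseteq> verts (graph D)"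
    "p \<in> {top_path D, bot_path D} \<Longrightarrow> init_vertex D \<in> path_verts D p"
    "p \<in> {top_path D, bot_path D} \<Longrightarrow> term_vertex D \<in> path_verts D p"
proof -
  assume "p \<in> {top_path D, bot_path D}"
  then have p: "pre_digraph.cas (graph D) (init_vertex D) p (term_vertex D)" "p \<noteq> []"
    "set p \<subseteq> arcs (graph D)"
    using assms by (auto simp: well_formed_def)
  show "set (pre_digraph.awalk_verts (graph D) (init_vertex D) p) = path_verts D p"
    using cas_verts[OF p(1)] cas_tail_hd[OF p(1,2)] by (simp add: path_verts_def)
  have "hd p \<in> set p" "last p \<in> set p" using p(2) by simp_all
  then show "path_verts D p \<subseteq> verts (graph D)" "init_vertex D \<in> path_verts D p"
    "term_vertex D \<in> path_verts D p"
    using assms p(3) cas_tail_hd[OF p(1,2), symmetric] cas_head_last[OF p(1,2), symmetric]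
    by (auto simp: path_verts_def well_formed_def)
qed

lemma well_formed_paths:
  assumes "well_formed D"
  shows "top_path D \<noteq> []" "bot_path D \<noteq> []"
    "set (top_path D) \<subseteq> arcs (graph D)" "set (bot_path D) \<subseteq> arcs (graph D)"
  using assms by (simp_all add: well_formed_def)

lemma well_formed_arc:
  assumes "well_formed D" "e \<in> arcs (graph D)"
  shows "tail (graph D) e \<in> verts (graph D)" "head (graph D) e \<in> verts (graph D)"
  using assms by (simp_all add: well_formed_def)

lemma well_formed_cell:
  assumes "well_formed D" "c \<in> cells D"
  shows "set (fst c) \<subseteq> arcs (graph D)" "set (snd c) \<subseteq> arcs (graph D)"
  using assms by (simp_all add: well_formed_def)

lemma multipliableD:
  assumes "multipliable D E" "well_formed D"
  shows "tail (graph E) = tail (graph D)" "head (graph E) = head (graph D)"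
    "top_path E = bot_path D" "arcs (graph D) \<inter> arcs (graph E) = set (bot_path D)"
    "verts (graph D) \<inter> verts (graph E) = path_verts D (bot_path D)"
  using assms path_verts_walk(1)[OF assms(2)] by (auto simp: multipliable_def compatible_def)

lemma addableD:
  assumes "addable D E"
  shows "tail (graph E) = tail (graph D)" "head (graph E) = head (graph D)"
    "init_vertex E = term_vertex D" "arcs (graph D) \<inter> arcs (graph E) = {}"
    "verts (graph D) \<inter> verts (graph E) = {term_vertex D}"
  using assms by (auto simp: addable_def compatible_def)

lemma multipliable_dinv:
  assumes "multipliable D E" "well_formed D" "well_formed E"
  shows "multipliable (dinv E) (dinv D)"
proof -
  note m = multipliableD[OF assms(1,2)]
  have w: "set (pre_digraph.awalk_verts (graph E) (init_vertex E) (top_path E)) = path_verts E (top_path E)"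
    using path_verts_walk(1)[OF assms(3)] by simp
  have "path_verts E (top_path E) = path_verts D (bot_path D)"
    using m by (simp add: path_verts_def)
  then show ?thesis using m well_formed_dinv_ends[OF assms(3)] w
    by (auto simp: multipliable_def compatible_def)
qed

lemma addable_dinv:
  assumes "addable D E" "well_formed D" "well_formed E"
  shows "addable (dinv D) (dinv E)"
  using assms by (simp add: addable_def well_formed_dinv_ends)

text \<open>The diagrams generated without inversion.  Induction over \<^const>\<open>is_diagram\<close> would have to carry
  every property together with its mirror image; here the cells all point the same way.\<close>
inductive pos_diagram :: "diagram \<Rightarrow> bool" where
  edge: "edge_diagram D \<Longrightarrow> pos_diagram D"
| cell: "pi_diagram D \<Longrightarrow> pos_diagram D"
| add: "pos_diagram D \<Longrightarrow> pos_diagram E \<Longrightarrow> addable D E \<Longrightarrow> pos_diagram (dadd D E)"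
| mult: "pos_diagram D \<Longrightarrow> pos_diagram E \<Longrightarrow> multipliable D E \<Longrightarrow> pos_diagram (dmult D E)"

lemma pos_diagram_is_diagram: "pos_diagram D \<Longrightarrow> is_diagram D"
  by (induction rule: pos_diagram.induct) (auto intro: is_diagram.intros)

lemmas pos_diagram_well_formed = is_diagram_well_formed[OF pos_diagram_is_diagram]

text \<open>Inversion exchanges the two kinds of cells, so both claims have to be proved together; each
  inversion then swaps them.\<close>
lemma is_diagram_one_sign:
  assumes "is_diagram D"
  shows "((\<forall>c\<in>cells D. pi_cell c) \<longrightarrow> pos_diagram D) \<and>
    ((\<forall>c\<in>cells D. pi_inv_cell c) \<longrightarrow> pos_diagram (dinv D))"
  using assms
proof (induction rule: is_diagram.induct)
  case (edge D)
  then have "edge_diagram (dinv D)" by (auto simp: edge_diagram_def)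
  with edge show ?case by (blast intro: pos_diagram.edge)
next
  case (cell D)
  then have "\<not> (\<forall>c\<in>cells D. pi_inv_cell c)"
    by (auto simp: pi_diagram_def pi_inv_cell_def)
  with cell show ?case by (blast intro: pos_diagram.cell)
next
  case (add D E)
  have "addable (dinv D) (dinv E)" using add by (intro addable_dinv is_diagram_well_formed)
  with add show ?case by (auto simp: dinv_dadd intro!: pos_diagram.add)
next
  case (mult D E)
  have "multipliable (dinv E) (dinv D)" using mult by (intro multipliable_dinv is_diagram_well_formed)
  moreover have "compatible (graph D) (graph E)" using mult by (simp add: multipliable_def)
  ultimately show ?case using mult by (auto simp: dinv_dmult intro!: pos_diagram.mult)
next
  case (inv D)
  have "pi_cell (prod.swap c) = pi_inv_cell c" "pi_inv_cell (prod.swap c) = pi_cell c" for c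
    by (auto simp: pi_cell_def pi_inv_cell_def)
  with inv show ?case by auto
qed

lemma pos_diagram_cell:
  assumes "pos_diagram D" "c \<in> cells D"
  obtains e l r where "c = ([e], [l, r])" "l \<noteq> r" "{e, l, r} \<subseteq> arcs (graph D)"
    "tail (graph D) l = tail (graph D) e" "head (graph D) r = head (graph D) e"
    "tail (graph D) r = head (graph D) l"
proof -
  have "\<exists>e l r. c = ([e], [l, r]) \<and> l \<noteq> r \<and> {e, l, r} \<subseteq> arcs (graph D) \<and>
    tail (graph D) l = tail (graph D) e \<and> head (graph D) r = head (graph D) e \<and>
    tail (graph D) r = head (graph D) l"
    using assms
  proof (induction rule: pos_diagram.induct)
    case (edge D) then show ?case by (auto simp: edge_diagram_def)
  next
    case (cell D) then show ?case by (fastforce simp: pi_diagram_def)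
  next
    case (add D E) then show ?case by (auto simp: addable_def compatible_def)
  next
    case (mult D E) then show ?case by (auto simp: multipliable_def compatible_def)
  qed
  then show thesis using that by blast
qed

text \<open>A diagram without negative cells is a forest that grows from its top path, each cell adding two
  children below an arc.  This is induction along the forest; the next lemma runs from the leaves
  upwards.\<close>
lemma arcs_induct_top:
  assumes "pos_diagram D" "e \<in> arcs (graph D)"
    and "\<And>e. e \<in> set (top_path D) \<Longrightarrow> Q e"
    and "\<And>e l r. ([e], [l, r]) \<in> cells D \<Longrightarrow> Q e \<Longrightarrow> Q l \<and> Q r"
  shows "Q e"
  using assms
proof (induction arbitrary: e rule: pos_diagram.induct)
  case (edge D) then show ?case by (auto simp: edge_diagram_def)
next
  case (cell D)
  then obtain p l r where "arcs (graph D) = {p, l, r}" "top_path D = [p]" "([p], [l, r]) \<in> cells D"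
    unfolding pi_diagram_def by (elim exE conjE) simp
  then show ?case using cell.prems by auto
next
  case (add D E)
  have "Q e" if "e \<in> arcs (graph D)" for e using add.IH(1)[OF that] add.prems by auto
  moreover have "Q e" if "e \<in> arcs (graph E)" for e using add.IH(2)[OF that] add.prems by auto
  ultimately show ?case using add.prems(1) by auto
next
  case (mult D E)
  have D: "Q e" if "e \<in> arcs (graph D)" for e using mult.IH(1)[OF that] mult.prems by auto
  have "set (bot_path D) \<subseteq> arcs (graph D)"
    by (rule well_formed_paths[OF pos_diagram_well_formed[OF mult(1)]])
  then have top: "Q e" if "e \<in> set (top_path E)" for e
    using D that mult(3) by (auto simp: multipliable_def)
  have "Q e" if "e \<in> arcs (graph E)" for e
    by (rule mult.IH(2)[OF that top]) (use mult.prems in auto)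
  then show ?case using D mult.prems(1) by auto
qed

lemma arcs_induct_bot:
  assumes "pos_diagram D" "e \<in> arcs (graph D)"
    and "\<And>e. e \<in> set (bot_path D) \<Longrightarrow> Q e"
    and "\<And>e l r. ([e], [l, r]) \<in> cells D \<Longrightarrow> Q l \<Longrightarrow> Q r \<Longrightarrow> Q e"
  shows "Q e"
  using assms
proof (induction arbitrary: e rule: pos_diagram.induct)
  case (edge D) then show ?case by (auto simp: edge_diagram_def)
next
  case (cell D)
  then obtain p l r where "arcs (graph D) = {p, l, r}" "bot_path D = [l, r]" "([p], [l, r]) \<in> cells D"
    unfolding pi_diagram_def by (elim exE conjE) simp
  then show ?case using cell.prems by auto
next
  case (add D E)
  have "Q e" if "e \<in> arcs (graph D)" for e using add.IH(1)[OF that] add.prems by auto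
  moreover have "Q e" if "e \<in> arcs (graph E)" for e using add.IH(2)[OF that] add.prems by auto
  ultimately show ?case using add.prems(1) by auto
next
  case (mult D E)
  have E: "Q e" if "e \<in> arcs (graph E)" for e using mult.IH(2)[OF that] mult.prems by auto
  have "set (top_path E) \<subseteq> arcs (graph E)"
    by (rule well_formed_paths[OF pos_diagram_well_formed[OF mult(2)]])
  then have bot: "Q e" if "e \<in> set (bot_path D)" for e
    using E that mult(3) by (auto simp: multipliable_def)
  have "Q e" if "e \<in> arcs (graph D)" for e
    by (rule mult.IH(1)[OF that bot]) (use mult.prems in auto)
  then show ?case using E mult.prems(1) by auto
qed

text \<open>A cell \<open>\<pi>\<close> never hides a vertex: each new cell passes the two ends of its top edge on to its
  bottom path and adds one more vertex there.\<close>
lemma pos_diagram_verts_bot: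
  assumes "pos_diagram D"
  shows "verts (graph D) = path_verts D (bot_path D)"
proof
  show "path_verts D (bot_path D) \<subseteq> verts (graph D)"
    using path_verts_walk(2)[OF pos_diagram_well_formed[OF assms]] by simp
  show "verts (graph D) \<subseteq> path_verts D (bot_path D)" using assms
  proof (induction rule: pos_diagram.induct)
    case (edge D) then show ?case by (auto simp: edge_diagram_def path_verts_def)
  next
    case (cell D) then show ?case by (auto simp: pi_diagram_def path_verts_def)
  next
    case (add D E)
    have "bot_path D \<noteq> []" "tail (graph E) (hd (bot_path E)) = init_vertex E"
      "term_vertex D = head (graph D) (last (bot_path D))"
      using pos_diagram_well_formed[OF add(1)] pos_diagram_well_formed[OF add(2)]
      by (auto simp: well_formed_def intro: cas_tail_hd dest: cas_head_last)
    then show ?case using add.IH addableD[OF add(3)] by (auto simp: path_verts_def)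
  next
    case (mult D E)
    have "path_verts D (bot_path D) \<subseteq> verts (graph E)"
      using multipliableD(5)[OF mult(3) pos_diagram_well_formed[OF mult(1)]] by blast
    then show ?case using mult.IH multipliableD[OF mult(3) pos_diagram_well_formed[OF mult(1)]]
      by (auto simp: path_verts_def)
  qed
qed

text \<open>In the forest, an arc at the bottom has no children, an arc at the top has no parent, and no arc
  has two parents.  In each inductive step, arcs from different parts can only coincide on the
  path along which the parts are glued.\<close>
lemma cell_top_not_bot:
  assumes "pos_diagram D" "([e], [l, r]) \<in> cells D"
  shows "e \<notin> set (bot_path D)"
  using assms
proof (induction rule: pos_diagram.induct)
  case (edge D) then show ?case by (auto simp: edge_diagram_def)
next
  case (cell D) then show ?case by (auto simp: pi_diagram_def)
next
  case (add D E)
  note wfD = pos_diagram_well_formed[OF add(1)] and wfE = pos_diagram_well_formed[OF add(2)]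
  from add.prems consider "([e], [l, r]) \<in> cells D" | "([e], [l, r]) \<in> cells E" by auto
  then show ?case
  proof cases
    case 1
    then show ?thesis using add.IH addableD(4)[OF add(3)] well_formed_cell[OF wfD 1] well_formed_paths[OF wfE]
      by auto
  next
    case 2
    then show ?thesis using add.IH addableD(4)[OF add(3)] well_formed_cell[OF wfE 2] well_formed_paths[OF wfD]
      by auto
  qed
next
  case (mult D E)
  note wfD = pos_diagram_well_formed[OF mult(1)] and wfE = pos_diagram_well_formed[OF mult(2)]
  note a = multipliableD(3,4)[OF mult(3) wfD]
  from mult.prems consider "([e], [l, r]) \<in> cells D" | "([e], [l, r]) \<in> cells E" by auto
  then show ?case
  proof cases
    case 1
    then have "e \<notin> set (bot_path D)" by (rule mult.IH)
    then show ?thesis using a well_formed_cell[OF wfD 1] well_formed_paths[OF wfE] by auto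
  next
    case 2
    then show ?thesis using mult.IH by auto
  qed
qed

lemma cell_child_not_top:
  assumes "pos_diagram D" "([e], [l, r]) \<in> cells D"
  shows "{l, r} \<inter> set (top_path D) = {}"
  using assms
proof (induction rule: pos_diagram.induct)
  case (edge D) then show ?case by (auto simp: edge_diagram_def)
next
  case (cell D) then show ?case by (auto simp: pi_diagram_def)
next
  case (add D E)
  note wfD = pos_diagram_well_formed[OF add(1)] and wfE = pos_diagram_well_formed[OF add(2)]
  from add.prems consider "([e], [l, r]) \<in> cells D" | "([e], [l, r]) \<in> cells E" by auto
  then show ?case
  proof cases
    case 1
    then show ?thesis using add.IH addableD(4)[OF add(3)] well_formed_cell[OF wfD 1] well_formed_paths[OF wfE]
      by auto
  next
    case 2
    then show ?thesis using add.IH addableD(4)[OF add(3)] well_formed_cell[OF wfE 2] well_formed_paths[OF wfD]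
      by auto
  qed
next
  case (mult D E)
  note wfD = pos_diagram_well_formed[OF mult(1)] and wfE = pos_diagram_well_formed[OF mult(2)]
  note a = multipliableD(3,4)[OF mult(3) wfD]
  from mult.prems consider "([e], [l, r]) \<in> cells D" | "([e], [l, r]) \<in> cells E" by auto
  then show ?case
  proof cases
    case 1
    then show ?thesis using mult.IH by auto
  next
    case 2
    then have "{l, r} \<inter> set (bot_path D) = {}" using mult.IH a by simp
    then show ?thesis using a well_formed_cell[OF wfE 2] well_formed_paths[OF wfD] by auto
  qed
qed

lemma cell_parent_unique:
  assumes "pos_diagram D" "c \<in> cells D" "c' \<in> cells D" "set (snd c) \<inter> set (snd c') \<noteq> {}"
  shows "c = c'"
  using assms
proof (induction rule: pos_diagram.induct)
  case (edge D) then show ?case by (auto simp: edge_diagram_def)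
next
  case (cell D) then show ?case by (auto simp: pi_diagram_def)
next
  case (add D E)
  have "set (snd c) \<subseteq> arcs (graph D)" if "c \<in> cells D" for c
    using that pos_diagram_well_formed[OF add(1)] by (auto simp: well_formed_def)
  moreover have "set (snd c) \<subseteq> arcs (graph E)" if "c \<in> cells E" for c
    using that pos_diagram_well_formed[OF add(2)] by (auto simp: well_formed_def)
  ultimately have "set (snd c) \<inter> set (snd c') = {}" if "c \<in> cells D" "c' \<in> cells E" for c c'
    using that addableD(4)[OF add(3)] by blast
  moreover have "c \<in> cells D \<or> c \<in> cells E" "c' \<in> cells D \<or> c' \<in> cells E" using add.prems by auto
  ultimately show ?case using add.IH add.prems(3) by (metis Int_commute)
next
  case (mult D E)
  have "set (snd c) \<subseteq> arcs (graph D)" if "c \<in> cells D" for c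
    using that pos_diagram_well_formed[OF mult(1)] by (auto simp: well_formed_def)
  moreover have "set (snd c) \<subseteq> arcs (graph E)" "set (snd c) \<inter> set (bot_path D) = {}"
    if cE: "c \<in> cells E" for c
  proof -
    show "set (snd c) \<subseteq> arcs (graph E)"
      using cE pos_diagram_well_formed[OF mult(2)] by (auto simp: well_formed_def)
    obtain e l r where "c = ([e], [l, r])" by (rule pos_diagram_cell[OF mult(2) cE])
    then show "set (snd c) \<inter> set (bot_path D) = {}"
      using cell_child_not_top[OF mult(2), of e l r] cE
        multipliableD(3)[OF mult(3) pos_diagram_well_formed[OF mult(1)]] by auto
  qed
  ultimately have "set (snd c) \<inter> set (snd c') = {}" if "c \<in> cells D" "c' \<in> cells E" for c c'
    using that multipliableD(4)[OF mult(3) pos_diagram_well_formed[OF mult(1)]] by blast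
  moreover have "c \<in> cells D \<or> c \<in> cells E" "c' \<in> cells D \<or> c' \<in> cells E" using mult.prems by auto
  ultimately show ?case using mult.IH mult.prems(3) by (metis Int_commute)
qed

text \<open>The middle vertex of a cell \<open>\<pi>\<close> is the head of its left bottom edge.\<close>
definition creates :: "diagram \<Rightarrow> nat list \<times> nat list \<Rightarrow> nat \<Rightarrow> bool" where
  "creates D c v \<longleftrightarrow> c \<in> cells D \<and> head (graph D) (hd (snd c)) = v"

lemma created_vert:
  assumes "pos_diagram D" "creates D c v"
  shows "v \<in> verts (graph D)"
proof -
  note wf = pos_diagram_well_formed[OF assms(1)]
  have c: "c \<in> cells D" "head (graph D) (hd (snd c)) = v" using assms(2) by (auto simp: creates_def)
  obtain e l r where "c = ([e], [l, r])" "{e, l, r} \<subseteq> arcs (graph D)"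
    using assms(1) c(1) by (rule pos_diagram_cell)
  then show ?thesis using well_formed_arc(2)[OF wf, of l] c(2) by auto
qed

text \<open>A vertex shared by two glued parts lies on the top path of the lower (or right) part, so by
  this lemma at most one of the parts can create it; that is why \<open>creates_unique\<close> holds.\<close>
lemma created_not_top:
  assumes "pos_diagram D" "creates D c v"
  shows "v \<notin> path_verts D (top_path D)"
  using assms
proof (induction rule: pos_diagram.induct)
  case (edge D) then show ?case by (auto simp: edge_diagram_def creates_def)
next
  case (cell D) then show ?case by (auto simp: pi_diagram_def creates_def path_verts_def)
next
  case (add D E)
  note wfD = pos_diagram_well_formed[OF add(1)] and wfE = pos_diagram_well_formed[OF add(2)]
  note a = addableD[OF add(3)]
  have "v \<in> verts (graph D)" if "creates D c v"
    using add(1) that by (rule created_vert)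
  moreover have "v \<in> verts (graph E)" if "creates E c v"
    using add(2) that by (rule created_vert)
  moreover have "creates D c v \<or> creates E c v" using add.prems a by (auto simp: creates_def)
  moreover have "path_verts (dadd D E) (top_path (dadd D E)) \<subseteq>
      path_verts D (top_path D) \<union> path_verts E (top_path E)"
    using wfD a by (auto simp: path_verts_def well_formed_def)
  ultimately show ?case using add.IH a(3,5) path_verts_walk[OF wfD] path_verts_walk[OF wfE]
    by (smt (verit, ccfv_threshold) IntI Un_iff insertI1 singletonD subsetD)
next
  case (mult D E)
  note wfD = pos_diagram_well_formed[OF mult(1)] and wfE = pos_diagram_well_formed[OF mult(2)]
  note a = multipliableD[OF mult(3) wfD]
  have E: "v \<in> verts (graph E)" if "creates E c v"
    using mult(2) that by (rule created_vert)
  have "path_verts E (top_path E) = path_verts D (bot_path D)" using a by (simp add: path_verts_def)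
  moreover have "creates D c v \<or> creates E c v" using mult.prems a by (auto simp: creates_def)
  moreover have "path_verts (dmult D E) (top_path (dmult D E)) = path_verts D (top_path D)"
    by (auto simp: path_verts_def)
  ultimately show ?case using mult.IH a(5) path_verts_walk(2)[OF wfD] E by blast
qed

lemma creates_unique:
  assumes "pos_diagram D" "creates D c v" "creates D c' v"
  shows "c = c'"
  using assms
proof (induction rule: pos_diagram.induct)
  case (edge D) then show ?case by (auto simp: edge_diagram_def creates_def)
next
  case (cell D) then show ?case by (auto simp: pi_diagram_def creates_def)
next
  case (add D E)
  note wfD = pos_diagram_well_formed[OF add(1)] and wfE = pos_diagram_well_formed[OF add(2)]
  note a = addableD[OF add(3)]
  have "v \<in> verts (graph D) \<and> v \<noteq> term_vertex D" if "creates D c v" for c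
    using created_vert[OF add(1) that] created_not_top[OF add(1) that] path_verts_walk(4)[OF wfD] by auto
  moreover have "v \<in> verts (graph E)" if "creates E c v" for c
    using add(2) that by (rule created_vert)
  moreover have "creates D c v \<or> creates E c v" "creates D c' v \<or> creates E c' v"
    using add.prems a by (auto simp: creates_def)
  ultimately show ?case using add.IH a(5) by blast
next
  case (mult D E)
  note wfD = pos_diagram_well_formed[OF mult(1)] and wfE = pos_diagram_well_formed[OF mult(2)]
  note a = multipliableD[OF mult(3) wfD]
  have "v \<in> verts (graph D)" if "creates D c v" for c
    using mult(1) that by (rule created_vert)
  moreover have "v \<in> verts (graph E)" if "creates E c v" for c
    using mult(2) that by (rule created_vert)
  moreover have "path_verts E (top_path E) = path_verts D (bot_path D)" using a by (simp add: path_verts_def)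
  moreover have "creates D c v \<or> creates E c v" "creates D c' v \<or> creates E c' v"
    using mult.prems a by (auto simp: creates_def)
  ultimately show ?case using mult.IH a(5) created_not_top[OF mult(2)] by blast
qed

definition positions :: "diagram \<Rightarrow> (nat \<Rightarrow> real) \<Rightarrow> bool" where
  "positions D x \<longleftrightarrow> (\<forall>e l r. ([e], [l, r]) \<in> cells D \<longrightarrow>
     x (head (graph D) l) = (x (tail (graph D) e) + x (head (graph D) e)) / 2)"

lemma positions_glue:
  assumes "well_formed D" "well_formed E" "positions D x" "positions E y"
    and agree: "\<And>v. v \<in> verts (graph D) \<Longrightarrow> v \<in> verts (graph E) \<Longrightarrow> x v = y v"
    and same: "tail (graph E) = tail (graph D)" "head (graph E) = head (graph D)"
      "tail (graph F) = tail (graph D)" "head (graph F) = head (graph D)"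
      "cells F = cells D \<union> cells E"
  shows "\<exists>z. positions F z \<and> (\<forall>v\<in>verts (graph D). z v = x v) \<and> (\<forall>v\<in>verts (graph E). z v = y v)"
proof -
  define z where "z v = (if v \<in> verts (graph D) then x v else y v)" for v
  have zx: "\<forall>v\<in>verts (graph D). z v = x v" by (simp add: z_def)
  have zy: "\<forall>v\<in>verts (graph E). z v = y v" using agree by (simp add: z_def)
  have "z (head (graph F) l) = (z (tail (graph F) e) + z (head (graph F) e)) / 2"
    if "([e], [l, r]) \<in> cells F" for e l r
  proof -
    from that same(5) consider "([e], [l, r]) \<in> cells D" | "([e], [l, r]) \<in> cells E" by auto
    then show ?thesis
    proof cases
      case 1
      then have "e \<in> arcs (graph D)" "l \<in> arcs (graph D)" using well_formed_cell[OF assms(1)] by force+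
      then show ?thesis using zx well_formed_arc[OF assms(1)] assms(3)[unfolded positions_def, rule_format, OF 1] same
        by simp
    next
      case 2
      then have "e \<in> arcs (graph E)" "l \<in> arcs (graph E)" using well_formed_cell[OF assms(2)] by force+
      then show ?thesis using zy well_formed_arc[OF assms(2)] assms(4)[unfolded positions_def, rule_format, OF 2] same
        by simp
    qed
  qed
  then have "positions F z" by (simp add: positions_def)
  with zx zy show ?thesis by blast
qed

text \<open>The values on the top path can be prescribed freely.  This generality is what the induction
  needs: in a product, the lower factor has to start from the positions reached on the bottom path
  of the upper one.\<close>
lemma positions_exist:
  assumes "pos_diagram D"
  shows "\<exists>x. positions D x \<and> (\<forall>v\<in>path_verts D (top_path D). x v = q v)"
  using assms
proof (induction arbitrary: q rule: pos_diagram.induct)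
  case (edge D) then show ?case by (auto simp: edge_diagram_def positions_def)
next
  case (cell D)
  then obtain u w v e l r where D: "distinct [u, w, v]" "tail (graph D) e = u" "head (graph D) e = v"
    "head (graph D) l = w" "top_path D = [e]" "cells D = {([e], [l, r])}"
    unfolding pi_diagram_def by (elim exE conjE) (rule that, assumption+)
  let ?x = "q(w := (q u + q v) / 2)"
  have "positions D ?x" using D by (auto simp: positions_def)
  moreover have "\<forall>v\<in>path_verts D (top_path D). ?x v = q v" using D by (auto simp: path_verts_def)
  ultimately show ?case by blast
next
  case (add D E)
  note wfD = pos_diagram_well_formed[OF add(1)] and wfE = pos_diagram_well_formed[OF add(2)]
  note a = addableD[OF add(3)]
  obtain x where x: "positions D x" "\<forall>v\<in>path_verts D (top_path D). x v = q v" using add.IH by blast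
  obtain y where y: "positions E y" "\<forall>v\<in>path_verts E (top_path E). y v = q v" using add.IH by blast
  have "x v = y v" if "v \<in> verts (graph D)" "v \<in> verts (graph E)" for v
  proof -
    have "v = term_vertex D" "v = init_vertex E" using that a(3,5) by auto
    then show ?thesis using x(2) y(2) path_verts_walk(4)[OF wfD] path_verts_walk(3)[OF wfE] by auto
  qed
  then obtain z where z: "positions (dadd D E) z" "\<forall>v\<in>verts (graph D). z v = x v"
    "\<forall>v\<in>verts (graph E). z v = y v"
    using positions_glue[OF wfD wfE x(1) y(1), of "dadd D E"] a(1,2) by auto
  have "path_verts (dadd D E) (top_path (dadd D E)) \<subseteq>
      path_verts D (top_path D) \<union> path_verts E (top_path E)"
    using well_formed_paths(1)[OF wfD] a(2) by (auto simp: path_verts_def)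
  moreover have "z v = q v" if "v \<in> path_verts D (top_path D)" for v
    using that x(2) z(2) path_verts_walk(2)[OF wfD, of "top_path D"] by auto
  moreover have "z v = q v" if "v \<in> path_verts E (top_path E)" for v
    using that y(2) z(3) path_verts_walk(2)[OF wfE, of "top_path E"] by auto
  ultimately have "\<forall>v\<in>path_verts (dadd D E) (top_path (dadd D E)). z v = q v"
    by (metis UnE subsetD)
  with z(1) show ?case by metis
next
  case (mult D E)
  note wfD = pos_diagram_well_formed[OF mult(1)] and wfE = pos_diagram_well_formed[OF mult(2)]
  note a = multipliableD[OF mult(3) wfD]
  obtain x where x: "positions D x" "\<forall>v\<in>path_verts D (top_path D). x v = q v" using mult.IH by blast
  obtain y where y: "positions E y" "\<forall>v\<in>path_verts E (top_path E). y v = x v" using mult.IH by blast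
  have "path_verts E (top_path E) = path_verts D (bot_path D)" using a by (simp add: path_verts_def)
  then have "x v = y v" if "v \<in> verts (graph D)" "v \<in> verts (graph E)" for v
    using that a(5) y(2) by (metis IntI)
  then obtain z where z: "positions (dmult D E) z" "\<forall>v\<in>verts (graph D). z v = x v"
    using positions_glue[OF wfD wfE x(1) y(1), of "dmult D E"] a(1,2) by auto
  have "path_verts (dmult D E) (top_path (dmult D E)) = path_verts D (top_path D)"
    by (simp add: path_verts_def)
  then have "\<forall>v\<in>path_verts (dmult D E) (top_path (dmult D E)). z v = q v"
    using x(2) z(2) path_verts_walk(2)[OF wfD, of "top_path D"] by auto
  with z(1) show ?case by metis
qed

section \<open>Positions of vertices and intervals of edges\<close>

lemma pos_diagram_no_loops: "pos_diagram D \<Longrightarrow> e \<in> arcs (graph D) \<Longrightarrow> tail (graph D) e \<noteq> head (graph D) e"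
proof (induction arbitrary: e rule: pos_diagram.induct)
  case (edge D) then show ?case by (auto simp: edge_diagram_def)
next
  case (cell D)
  from cell(1) obtain u w v p l r where "distinct [u, w, v]" "arcs (graph D) = {p, l, r}"
    "tail (graph D) p = u" "head (graph D) p = v" "tail (graph D) l = u" "head (graph D) l = w"
    "tail (graph D) r = w" "head (graph D) r = v"
    unfolding pi_diagram_def by (elim exE conjE) (rule that, assumption+)
  then show ?case using cell(2) by auto
next
  case (add D E) then show ?case by (auto simp: addable_def compatible_def)
next
  case (mult D E) then show ?case by (auto simp: multipliable_def compatible_def)
qed

text \<open>With a single top edge from 0 to 1, the positions are the ends of the intervals assigned to the
  edges.\<close>
definition unit_positions :: "diagram \<Rightarrow> (nat \<Rightarrow> real) \<Rightarrow> bool" where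
  "unit_positions D x \<longleftrightarrow> positions D x \<and> x (init_vertex D) = 0 \<and> x (term_vertex D) = 1"

lemma unit_positions_exist:
  assumes "pos_diagram D" "length (top_path D) = 1"
  shows "\<exists>x. unit_positions D x"
proof -
  obtain e where e: "top_path D = [e]" using assms(2) by (auto simp: length_Suc_conv)
  then have "e \<in> arcs (graph D)" using well_formed_paths(3)[OF pos_diagram_well_formed[OF assms(1)]] by simp
  then have ne: "init_vertex D \<noteq> term_vertex D"
    using pos_diagram_no_loops[OF assms(1)] e by (simp add: init_vertex_def term_vertex_def)
  obtain x where x: "positions D x"
    "\<forall>v\<in>path_verts D (top_path D). x v = (if v = init_vertex D then 0 else 1)"
    using positions_exist[OF assms(1), of "\<lambda>v. if v = init_vertex D then 0 else 1"] by blast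
  then have "x (init_vertex D) = 0" "x (term_vertex D) = 1"
    using ne e by (auto simp: path_verts_def init_vertex_def term_vertex_def)
  with x(1) show ?thesis unfolding unit_positions_def by blast
qed

lemma cell_incidence:
  assumes "pos_diagram D" "([e], [l, r]) \<in> cells D"
  shows "tail (graph D) l = tail (graph D) e" "head (graph D) r = head (graph D) e"
    "tail (graph D) r = head (graph D) l" "e \<in> arcs (graph D)" "l \<in> arcs (graph D)" "r \<in> arcs (graph D)"
  by (rule pos_diagram_cell[OF assms]; simp)+

lemma edge_interval_positions:
  assumes "pos_diagram D" "length (top_path D) = 1" "unit_positions D x" "edge_interval D e a b"
  shows "a = x (tail (graph D) e) \<and> b = x (head (graph D) e) \<and> standard_interval a b"
  using assms(4)
proof induction
  case (top e)
  then show ?case using assms(3) standard_interval_unit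
    by (simp add: unit_positions_def init_vertex_def term_vertex_def)
next
  case (left e a b l r)
  have "x (head (graph D) l) = (x (tail (graph D) e) + x (head (graph D) e)) / 2"
    using left(2) assms(3) unfolding unit_positions_def positions_def by blast
  then show ?case
    using left.IH cell_incidence[OF assms(1) left(2)] standard_interval_halves(1)[of a b] by auto
next
  case (right e a b l r)
  have "x (head (graph D) l) = (x (tail (graph D) e) + x (head (graph D) e)) / 2"
    using right(2) assms(3) unfolding unit_positions_def positions_def by blast
  then show ?case
    using right.IH cell_incidence[OF assms(1) right(2)] standard_interval_halves(2)[of a b] by auto
qed

lemma edge_interval_exists:
  assumes "pos_diagram D" "length (top_path D) = 1" "e \<in> arcs (graph D)"
  shows "\<exists>a b. edge_interval D e a b"
  using assms(1,3)
proof (rule arcs_induct_top)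
  fix e assume "e \<in> set (top_path D)"
  then have "top_path D = [e]" using assms(2) by (auto simp: length_Suc_conv)
  then show "\<exists>a b. edge_interval D e a b" using edge_interval.top by blast
next
  fix e l r assume "([e], [l, r]) \<in> cells D" "\<exists>a b. edge_interval D e a b"
  then show "(\<exists>a b. edge_interval D l a b) \<and> (\<exists>a b. edge_interval D r a b)"
    using edge_interval.left edge_interval.right by blast
qed

lemma arc_standard:
  assumes "pos_diagram D" "length (top_path D) = 1" "unit_positions D x" "e \<in> arcs (graph D)"
  shows "standard_interval (x (tail (graph D) e)) (x (head (graph D) e))"
  using edge_interval_exists[OF assms(1,2,4)] edge_interval_positions[OF assms(1,2,3)] by blast

lemma cell_positions:
  assumes "pos_diagram D" "length (top_path D) = 1" "unit_positions D x" "([e], [l, r]) \<in> cells D"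
  shows "standard_interval (x (tail (graph D) e)) (x (head (graph D) e))"
    "x (tail (graph D) e) < x (head (graph D) l)" "x (head (graph D) l) < x (head (graph D) e)"
    "x (head (graph D) l) \<in> odd_digit_sum_dyadics \<longleftrightarrow> x (tail (graph D) e) \<notin> odd_digit_sum_dyadics"
proof -
  show std: "standard_interval (x (tail (graph D) e)) (x (head (graph D) e))"
    using arc_standard[OF assms(1-3)] cell_incidence[OF assms(1,4)] by auto
  have mid: "x (head (graph D) l) = (x (tail (graph D) e) + x (head (graph D) e)) / 2"
    using assms(3,4) unfolding unit_positions_def positions_def by blast
  show "x (tail (graph D) e) < x (head (graph D) l)" "x (head (graph D) l) < x (head (graph D) e)"
    using standard_interval_bounds(2)[OF std] by (simp_all add: mid)
  show "x (head (graph D) l) \<in> odd_digit_sum_dyadics \<longleftrightarrow> x (tail (graph D) e) \<notin> odd_digit_sum_dyadics"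
    unfolding mid by (rule midpoint_flips_parity[OF std])
qed

section \<open>The Thompson graph\<close>

text \<open>From an arc that is a right child one passes to its parent, which has the same head; this ends at
  the top edge or at a left child, whose cell creates the common head.\<close>
lemma directly_above_leftmost:
  assumes "pos_diagram D" "length (top_path D) = 1" "f \<in> arcs (graph D)"
  shows "head (graph D) f = term_vertex D \<or>
    (\<exists>c. creates D c (head (graph D) f) \<and> (directly_above D)\<^sup>*\<^sup>* (hd (snd c)) f)"
  using assms(1,3)
proof (rule arcs_induct_top)
  fix e assume "e \<in> set (top_path D)"
  then have "top_path D = [e]" using assms(2) by (auto simp: length_Suc_conv)
  then show "head (graph D) e = term_vertex D \<or>
      (\<exists>c. creates D c (head (graph D) e) \<and> (directly_above D)\<^sup>*\<^sup>* (hd (snd c)) e)"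
    by (simp add: term_vertex_def)
next
  fix e l r assume c: "([e], [l, r]) \<in> cells D"
    and IH: "head (graph D) e = term_vertex D \<or>
      (\<exists>c. creates D c (head (graph D) e) \<and> (directly_above D)\<^sup>*\<^sup>* (hd (snd c)) e)"
  have "creates D ([e], [l, r]) (head (graph D) l)" using c by (simp add: creates_def)
  then have "\<exists>c. creates D c (head (graph D) l) \<and> (directly_above D)\<^sup>*\<^sup>* (hd (snd c)) l"
    by (intro exI[of _ "([e], [l, r])"]) simp
  moreover have "head (graph D) r = head (graph D) e"
    by (rule pos_diagram_cell[OF assms(1) c]) simp
  moreover have "directly_above D e r" using c unfolding directly_above_def by force
  ultimately show "(head (graph D) l = term_vertex D \<or>
      (\<exists>c. creates D c (head (graph D) l) \<and> (directly_above D)\<^sup>*\<^sup>* (hd (snd c)) l)) \<and>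
    (head (graph D) r = term_vertex D \<or>
      (\<exists>c. creates D c (head (graph D) r) \<and> (directly_above D)\<^sup>*\<^sup>* (hd (snd c)) r))"
    using IH by (metis rtranclp.rtrancl_into_rtrancl)
qed

text \<open>Descending to right children keeps the head and ends on the bottom path.\<close>
lemma directly_above_bot:
  assumes "pos_diagram D" "f \<in> arcs (graph D)"
  shows "\<exists>b\<in>set (bot_path D). head (graph D) b = head (graph D) f \<and> (directly_above D)\<^sup>*\<^sup>* f b"
  using assms
proof (rule arcs_induct_bot)
  fix e l r assume c: "([e], [l, r]) \<in> cells D"
    and r: "\<exists>b\<in>set (bot_path D). head (graph D) b = head (graph D) r \<and> (directly_above D)\<^sup>*\<^sup>* r b"
  have "head (graph D) r = head (graph D) e" by (rule pos_diagram_cell[OF assms(1) c]) simp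
  moreover have "directly_above D e r" using c unfolding directly_above_def by force
  ultimately show "\<exists>b\<in>set (bot_path D). head (graph D) b = head (graph D) e \<and> (directly_above D)\<^sup>*\<^sup>* e b"
    using r by (metis converse_rtranclp_into_rtranclp)
qed auto

text \<open>The intervals of the children are halves of the interval of the parent, so right ends cannot
  increase downwards.\<close>
lemma directly_above_nested:
  assumes "pos_diagram D" "length (top_path D) = 1" "unit_positions D x" "(directly_above D)\<^sup>*\<^sup>* e f"
  shows "x (head (graph D) f) \<le> x (head (graph D) e)"
  using assms(4)
proof induction
  case (step f f')
  then obtain c where c: "c \<in> cells D" "f \<in> set (fst c)" "f' \<in> set (snd c)"
    unfolding directly_above_def by blast
  obtain e' l r where elr: "c = ([e'], [l, r])" by (rule pos_diagram_cell[OF assms(1) c(1)])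
  note p = cell_positions[OF assms(1-3) c(1)[unfolded elr]]
  have "x (head (graph D) f') \<le> x (head (graph D) f)"
    using c(2,3) elr p(3) cell_incidence(2)[OF assms(1) c(1)[unfolded elr]] by auto
  with step show ?case by simp
qed simp

text \<open>The lower half of a diagram is kept as the positive diagram \<open>Q\<close>, of which the diagram contains
  the mirror image.  This makes the situation symmetric in \<open>P\<close> and \<open>Q\<close>.\<close>
definition glueable :: "diagram \<Rightarrow> diagram \<Rightarrow> bool" where
  "glueable P Q \<longleftrightarrow> pos_diagram P \<and> pos_diagram Q \<and> multipliable P (dinv Q) \<and>
     length (top_path P) = 1 \<and> length (top_path Q) = 1"

lemma glueable_sym: "glueable P Q \<Longrightarrow> glueable Q P"
  using multipliable_dinv[of P "dinv Q"] is_diagram_well_formed[OF is_diagram.inv]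
    pos_diagram_is_diagram pos_diagram_well_formed
  by (simp add: glueable_def)

lemma glueableD:
  assumes "glueable P Q"
  shows "pos_diagram P" "pos_diagram Q" "length (top_path P) = 1" "length (top_path Q) = 1"
    "tail (graph Q) = tail (graph P)" "head (graph Q) = head (graph P)" "bot_path Q = bot_path P"
    "arcs (graph P) \<inter> arcs (graph Q) = set (bot_path P)" "verts (graph Q) = verts (graph P)"
    "init_vertex Q = init_vertex P" "term_vertex Q = term_vertex P"
proof -
  show PQ: "pos_diagram P" "pos_diagram Q" "length (top_path P) = 1" "length (top_path Q) = 1"
    using assms by (auto simp: glueable_def)
  note wfP = pos_diagram_well_formed[OF PQ(1)]
  have wfQ: "well_formed (dinv Q)"
    by (rule is_diagram_well_formed[OF is_diagram.inv[OF pos_diagram_is_diagram[OF PQ(2)]]])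
  have m: "multipliable P (dinv Q)" using assms by (simp add: glueable_def)
  from multipliableD[OF m wfP]
  show 1: "tail (graph Q) = tail (graph P)" "head (graph Q) = head (graph P)" "bot_path Q = bot_path P"
    "arcs (graph P) \<inter> arcs (graph Q) = set (bot_path P)" by simp_all
  show "verts (graph Q) = verts (graph P)"
    using 1 by (simp add: pos_diagram_verts_bot[OF PQ(1)] pos_diagram_verts_bot[OF PQ(2)] path_verts_def)
  show "init_vertex Q = init_vertex P" "term_vertex Q = term_vertex P"
    using dmult_ends(3,4)[OF wfP wfQ m] well_formed_dinv_ends[OF pos_diagram_well_formed[OF PQ(2)]] by simp_all
qed

lemma directly_above_glue:
  "directly_above (dmult P (dinv Q)) e f \<longleftrightarrow> directly_above P e f \<or> directly_above Q f e"
  by (force simp: directly_above_def)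

lemma in_edges_glue:
  assumes "glueable P Q"
  shows "in_edges (dmult P (dinv Q)) v = in_edges P v \<union> in_edges Q v"
  using glueableD[OF assms] by (auto simp: in_edges_def)

text \<open>Going upwards from \<open>f\<close>, a step through a cell of the lower half would have to start from an arc
  shared by both halves that is the top edge of a cell of \<open>Q\<close>; but shared arcs are bottom arcs
  of \<open>Q\<close>.\<close>
lemma above_glue_stays:
  assumes "glueable P Q" "(directly_above (dmult P (dinv Q)))\<^sup>*\<^sup>* e f" "f \<in> arcs (graph P)"
  shows "e \<in> arcs (graph P) \<and> (directly_above P)\<^sup>*\<^sup>* e f"
  using assms(2)
proof (induction rule: converse_rtranclp_induct)
  case base then show ?case using assms(3) by simp
next
  case (step e e')
  note g = glueableD[OF assms(1)]
  have "\<not> directly_above Q e' e"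
  proof
    assume "directly_above Q e' e"
    then obtain c where c: "c \<in> cells Q" "e' \<in> set (fst c)" unfolding directly_above_def by blast
    obtain a l r where "c = ([a], [l, r])" "{a, l, r} \<subseteq> arcs (graph Q)"
      by (rule pos_diagram_cell[OF g(2) c(1)])
    then show False using cell_top_not_bot[OF g(2), of a l r] c step.IH g(7,8) by auto
  qed
  with step(1) have *: "directly_above P e e'" by (simp add: directly_above_glue)
  then have "e \<in> arcs (graph P)"
    using well_formed_cell(1)[OF pos_diagram_well_formed[OF g(1)]] unfolding directly_above_def by blast
  then show ?case using * step.IH by (meson converse_rtranclp_into_rtranclp)
qed

lemma created_inner:
  assumes "glueable P Q" "creates P c v"
  shows "v \<in> verts (graph P)" "v \<noteq> init_vertex P" "v \<noteq> term_vertex P"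
  using created_vert[of P c v] created_not_top[of P c v] glueableD(1)[OF assms(1)] assms(2)
    path_verts_walk(3,4)[OF pos_diagram_well_formed[of P], of "top_path P"] by auto

lemma inner_created:
  assumes "glueable P Q" "v \<in> verts (graph P)" "v \<noteq> init_vertex P" "v \<noteq> term_vertex P"
  shows "\<exists>c. creates P c v"
proof -
  note g = glueableD[OF assms(1)] and wf = pos_diagram_well_formed[OF glueableD(1)[OF assms(1)]]
  have "v \<in> path_verts P (bot_path P)" using assms(2) pos_diagram_verts_bot[OF g(1)] by simp
  moreover have "tail (graph P) (hd (bot_path P)) = init_vertex P"
    using well_formed_dinv_ends(1)[OF wf] by (simp add: init_vertex_def)
  ultimately obtain b where "b \<in> set (bot_path P)" "head (graph P) b = v"
    using assms(3) by (auto simp: path_verts_def)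
  then show ?thesis
    using directly_above_leftmost[OF g(1,3), of b] well_formed_paths(4)[OF wf] assms(4) by auto
qed

text \<open>The arcs that enter \<open>v\<close> form one chain: it starts with the left child \<open>l\<close> that created \<open>v\<close>,
  descends through right children of \<open>P\<close> to the bottom path, and climbs through the mirror image of
  the corresponding chain of \<open>Q\<close>.  No other arc can be the first one: an arc above \<open>l\<close> is the
  parent of \<open>l\<close>, whose interval reaches beyond \<open>v\<close>, or lies above it.\<close>
lemma topmost_glue:
  assumes "glueable P Q" "creates P ([a], [l, r]) v"
  shows "topmost_in (dmult P (dinv Q)) v e \<longleftrightarrow> e = l"
proof -
  let ?D = "dmult P (dinv Q)"
  note g = glueableD[OF assms(1)]
  have c: "([a], [l, r]) \<in> cells P" and v: "head (graph P) l = v"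
    using assms(2) by (auto simp: creates_def)
  obtain x where x: "unit_positions P x" using unit_positions_exist[OF g(1,3)] by blast
  note p = cell_positions[OF g(1,3) x c] and inc = cell_incidence[OF g(1) c]
  have P: "(directly_above ?D)\<^sup>*\<^sup>* e f" if "(directly_above P)\<^sup>*\<^sup>* e f" for e f
    using that by (rule rtranclp_mono[THEN predicate2D, rotated]) (auto simp: directly_above_glue)
  have Q: "(directly_above ?D)\<^sup>*\<^sup>* f e" if "(directly_above Q)\<^sup>*\<^sup>* e f" for e f
    using that by induction (auto simp: directly_above_glue intro: converse_rtranclp_into_rtranclp)
  have below_P: "(directly_above ?D)\<^sup>*\<^sup>* l f" if f: "f \<in> arcs (graph P)" "head (graph P) f = v" for f
  proof -
    obtain c' where c': "creates P c' v" "(directly_above P)\<^sup>*\<^sup>* (hd (snd c')) f"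
      using directly_above_leftmost[OF g(1,3) f(1)] f(2) created_inner(3)[OF assms] by auto
    then have "c' = ([a], [l, r])" using creates_unique[OF g(1) _ assms(2)] by blast
    then show ?thesis using c'(2) P by simp
  qed
  have below: "(directly_above ?D)\<^sup>*\<^sup>* l f" if f: "f \<in> in_edges ?D v" for f
  proof (cases "f \<in> arcs (graph P)")
    case True
    then show ?thesis using below_P f by (simp add: in_edges_def)
  next
    case False
    then have "f \<in> arcs (graph Q)" "head (graph Q) f = v" using f g(6) by (auto simp: in_edges_def)
    then obtain b where b: "b \<in> set (bot_path P)" "head (graph P) b = v" "(directly_above Q)\<^sup>*\<^sup>* f b"
      using directly_above_bot[OF g(2)] g(6,7) by auto
    then have "b \<in> arcs (graph P)" using g(8) by blast
    then have "(directly_above ?D)\<^sup>*\<^sup>* l b" using b(2) by (rule below_P)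
    then show ?thesis using Q[OF b(3)] by (rule rtranclp_trans)
  qed
  show ?thesis
  proof
    assume e: "topmost_in ?D v e"
    have "l \<in> in_edges ?D v" using inc(5) v by (simp add: in_edges_def)
    then have "(directly_above ?D)\<^sup>*\<^sup>* e l" using e by (simp add: topmost_in_def)
    then have "(directly_above P)\<^sup>*\<^sup>* e l" using above_glue_stays[OF assms(1)] inc(5) by blast
    then show "e = l"
    proof (cases rule: rtranclp.cases)
      case (rtrancl_into_rtrancl f)
      then obtain c' where c': "c' \<in> cells P" "f \<in> set (fst c')" "l \<in> set (snd c')"
        unfolding directly_above_def by blast
      then have "c' = ([a], [l, r])" using cell_parent_unique[OF g(1) c'(1) c] by auto
      then have "x (head (graph P) a) \<le> x (head (graph P) e)"
        using directly_above_nested[OF g(1,3) x] rtrancl_into_rtrancl(1) c'(2) by auto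
      moreover have "head (graph P) e = v" using e by (simp add: topmost_in_def in_edges_def)
      moreover have "x v < x (head (graph P) a)"
        using p(3) v by simp
      \<comment> \<open>The right end of the interval of \<open>e\<close> is at the same time \<open>x v\<close> and greater than \<open>x v\<close>.\<close>
      ultimately show ?thesis by simp
    qed simp
  next
    assume "e = l"
    then show "topmost_in ?D v e" using inc(5) v below by (auto simp: topmost_in_def in_edges_def)
  qed
qed

lemma botmost_glue_iff_topmost:
  assumes "glueable P Q"
  shows "botmost_in (dmult P (dinv Q)) v e \<longleftrightarrow> topmost_in (dmult Q (dinv P)) v e"
proof -
  have "directly_above (dmult Q (dinv P)) = (directly_above (dmult P (dinv Q)))\<inverse>\<inverse>"
    by (auto simp: fun_eq_iff directly_above_glue)
  then show ?thesis
    using in_edges_glue[OF assms] in_edges_glue[OF glueable_sym[OF assms]]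
    by (simp add: topmost_in_def botmost_in_def rtranclp_conversep Un_commute)
qed

text \<open>By \<open>topmost_glue\<close> the upper edges are the left bottom edges of the cells of \<open>P\<close>; by reflection the
  lower edges are those of the cells of \<open>Q\<close>.\<close>
lemma thompson_graph_arcs:
  assumes "glueable P Q"
  shows "arcs (thompson_graph (dmult P (dinv Q))) =
      {(l, Upper) | a l r. ([a], [l, r]) \<in> cells P} \<union> {(l, Lower) | a l r. ([a], [l, r]) \<in> cells Q}"
proof -
  note g = glueableD[OF assms]
  have inner: "inner_verts (dmult P (dinv Q)) = verts (graph P) - {init_vertex P, term_vertex P}"
    using g by (auto simp: inner_verts_def init_vertex_def term_vertex_def)
  have half: "{e. \<exists>v\<in>verts (graph P) - {init_vertex P, term_vertex P}. topmost_in (dmult P (dinv Q)) v e} =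
      {l. \<exists>a r. ([a], [l, r]) \<in> cells P}" if PQ: "glueable P Q" for P Q
  proof (intro set_eqI iffI)
    fix e assume "e \<in> {e. \<exists>v\<in>verts (graph P) - {init_vertex P, term_vertex P}.
      topmost_in (dmult P (dinv Q)) v e}"
    then obtain v where v: "v \<in> verts (graph P)" "v \<noteq> init_vertex P" "v \<noteq> term_vertex P"
      and e: "topmost_in (dmult P (dinv Q)) v e" by blast
    obtain c where c: "creates P c v" using inner_created[OF PQ v] by blast
    then have cell: "c \<in> cells P" by (simp add: creates_def)
    obtain a l r where "c = ([a], [l, r])" by (rule pos_diagram_cell[OF glueableD(1)[OF PQ] cell])
    then show "e \<in> {l. \<exists>a r. ([a], [l, r]) \<in> cells P}"
      using topmost_glue[OF PQ, of a l r v e] c e cell by auto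
  next
    fix l assume "l \<in> {l. \<exists>a r. ([a], [l, r]) \<in> cells P}"
    then obtain a r where "([a], [l, r]) \<in> cells P" by blast
    then have c: "creates P ([a], [l, r]) (head (graph P) l)" by (simp add: creates_def)
    then show "l \<in> {e. \<exists>v\<in>verts (graph P) - {init_vertex P, term_vertex P}.
      topmost_in (dmult P (dinv Q)) v e}"
      using topmost_glue[OF PQ c] created_inner[OF PQ c] by blast
  qed
  have "{e. \<exists>v\<in>verts (graph P) - {init_vertex P, term_vertex P}. botmost_in (dmult P (dinv Q)) v e} =
      {l. \<exists>a r. ([a], [l, r]) \<in> cells Q}"
    using half[OF glueable_sym[OF assms]] g by (simp add: botmost_glue_iff_topmost[OF assms])
  then have "{(e, Lower) | e v. v \<in> verts (graph P) - {init_vertex P, term_vertex P} \<and>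
        botmost_in (dmult P (dinv Q)) v e} = {(l, Lower) | a l r. ([a], [l, r]) \<in> cells Q}" by blast
  moreover have "{(e, Upper) | e v. v \<in> verts (graph P) - {init_vertex P, term_vertex P} \<and>
        topmost_in (dmult P (dinv Q)) v e} = {(l, Upper) | a l r. ([a], [l, r]) \<in> cells P}"
    using half[OF assms] by blast
  ultimately show ?thesis unfolding thompson_graph_def inner by (simp only: pre_digraph.select_convs)
qed

text \<open>A colour class \<open>A\<close> that separates the ends of every left bottom edge is determined by the colour of
  the initial vertex: down the forest, the left end of an arc determines the colour of the
  vertex created below it.  The terminal vertex is exempt, since it is the head of no such edge.\<close>
lemma two_colouring_is_parity:
  assumes "pos_diagram P" "length (top_path P) = 1" "unit_positions P x"
    and flip: "\<And>a l r. ([a], [l, r]) \<in> cells P \<Longrightarrow> (tail (graph P) l \<in> A) \<noteq> (head (graph P) l \<in> A)"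
    and v: "v \<in> verts (graph P)" "v \<noteq> term_vertex P"
  shows "v \<in> A \<longleftrightarrow> (init_vertex P \<in> A) \<noteq> (x v \<in> odd_digit_sum_dyadics)"
proof -
  define good where "good v \<longleftrightarrow> v = term_vertex P \<or>
    (v \<in> A \<longleftrightarrow> (init_vertex P \<in> A) \<noteq> (x v \<in> odd_digit_sum_dyadics))" for v
  have init: "good (init_vertex P)"
    using assms(3) zero_not_odd by (simp add: good_def unit_positions_def)
  have arc: "good (tail (graph P) e) \<and> good (head (graph P) e)" if "e \<in> arcs (graph P)" for e
    using assms(1) that
  proof (rule arcs_induct_top)
    fix e assume "e \<in> set (top_path P)"
    then have "top_path P = [e]" using assms(2) by (auto simp: length_Suc_conv)
    then show "good (tail (graph P) e) \<and> good (head (graph P) e)"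
      using init by (simp add: good_def init_vertex_def term_vertex_def)
  next
    fix a l r assume c: "([a], [l, r]) \<in> cells P"
      and a: "good (tail (graph P) a) \<and> good (head (graph P) a)"
    note p = cell_positions[OF assms(1-3) c] and inc = cell_incidence[OF assms(1) c]
    have "x (tail (graph P) a) < 1" using standard_interval_bounds[OF p(1)] by simp
    then have "tail (graph P) a \<noteq> term_vertex P" using assms(3) by (auto simp: unit_positions_def)
    then have "good (head (graph P) l)"
      using a flip[OF c] p(4) inc(1) by (auto simp: good_def)
    then show "(good (tail (graph P) l) \<and> good (head (graph P) l)) \<and>
        (good (tail (graph P) r) \<and> good (head (graph P) r))"
      using a inc by simp
  qed
  have "set (bot_path P) \<subseteq> arcs (graph P)" "bot_path P \<noteq> []"
    using well_formed_paths[OF pos_diagram_well_formed[OF assms(1)]] by auto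
  then have "good v" using v arc pos_diagram_verts_bot[OF assms(1)] 
    by (auto simp: path_verts_def subset_iff)
  then show ?thesis using v(2) by (simp add: good_def)
qed

text \<open>A colouring of the whole graph colours the upper and the lower edges simultaneously, so both parities
  must coincide with it, up to one exchange of colours that is fixed at the initial vertex.
  At the terminal vertex both positions are 1.\<close>
lemma bipartite_thompson_graph_iff:
  assumes PQ: "glueable P Q" and x: "unit_positions P x" and y: "unit_positions Q y"
  shows "bipartite (thompson_graph (dmult P (dinv Q))) \<longleftrightarrow>
    (\<forall>v\<in>verts (graph P). x v \<in> odd_digit_sum_dyadics \<longleftrightarrow> y v \<in> odd_digit_sum_dyadics)"
    (is "bipartite ?T \<longleftrightarrow> ?par")
proof -
  note g = glueableD[OF PQ]
  have T: "verts ?T = verts (graph P) - {term_vertex P}"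
    "tail ?T (e, s) = tail (graph P) e" "head ?T (e, s) = head (graph P) e" for e s
    using g by (auto simp: thompson_graph_def term_vertex_def)
  note arcs = thompson_graph_arcs[OF PQ]
  show ?thesis
  proof
    assume "bipartite ?T"
    then obtain A B where AB: "A \<inter> B = {}"
      "\<forall>e\<in>arcs ?T. tail ?T e \<in> A \<and> head ?T e \<in> B \<or> tail ?T e \<in> B \<and> head ?T e \<in> A"
      unfolding bipartite_def by (elim exE conjE) (rule that, assumption+)
    have upper: "(tail (graph P) l \<in> A) \<noteq> (head (graph P) l \<in> A)" if "([a], [l, r]) \<in> cells P" for a l r
    proof -
      have "(l, Upper) \<in> arcs ?T" using that unfolding arcs by blast
      from bspec[OF AB(2) this] AB(1) show ?thesis unfolding T by blast
    qed
    have lower: "(tail (graph Q) l \<in> A) \<noteq> (head (graph Q) l \<in> A)" if "([a], [l, r]) \<in> cells Q" for a l r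
    proof -
      have "(l, Lower) \<in> arcs ?T" using that unfolding arcs by blast
      from bspec[OF AB(2) this] AB(1) show ?thesis unfolding T g(5,6) by blast
    qed
    show ?par
    proof
      fix v assume v: "v \<in> verts (graph P)"
      show "x v \<in> odd_digit_sum_dyadics \<longleftrightarrow> y v \<in> odd_digit_sum_dyadics"
      proof (cases "v = term_vertex P")
        case True
        then show ?thesis using x y g(11) by (simp add: unit_positions_def)
      next
        case False
        have v': "v \<in> verts (graph Q)" "v \<noteq> term_vertex Q" using v False g(9,11) by simp_all
        have "v \<in> A \<longleftrightarrow> (init_vertex P \<in> A) \<noteq> (x v \<in> odd_digit_sum_dyadics)"
          by (rule two_colouring_is_parity[OF g(1,3) x _ v False]) (rule upper)
        moreover have "v \<in> A \<longleftrightarrow> (init_vertex Q \<in> A) \<noteq> (y v \<in> odd_digit_sum_dyadics)"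
          by (rule two_colouring_is_parity[OF g(2,4) y _ v']) (rule lower)
        ultimately show ?thesis using g(10) by auto
      qed
    qed
  next
    assume par: ?par
    let ?A = "{v \<in> verts ?T. x v \<in> odd_digit_sum_dyadics}"
    let ?B = "{v \<in> verts ?T. x v \<notin> odd_digit_sum_dyadics}"
    \<comment> \<open>Stated for an arbitrary pair in order to be used for \<open>Q\<close> and \<open>P\<close> exchanged as well.\<close>
    have flip: "{tail (graph P) l, head (graph P) l} \<subseteq> verts (graph P) - {term_vertex P} \<and>
        (x (tail (graph P) l) \<in> odd_digit_sum_dyadics \<longleftrightarrow> x (head (graph P) l) \<notin> odd_digit_sum_dyadics)"
      if PQ: "glueable P Q" and x: "unit_positions P x" and c: "([a], [l, r]) \<in> cells P"
      for P Q x a l r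
    proof -
      note g = glueableD[OF PQ]
      note p = cell_positions[OF g(1,3) x c] and inc = cell_incidence[OF g(1) c]
      have "x (tail (graph P) l) < 1" using standard_interval_bounds[OF p(1)] inc(1) by simp
      moreover have "x (term_vertex P) = 1" using x by (simp add: unit_positions_def)
      moreover have "creates P ([a], [l, r]) (head (graph P) l)" using c by (simp add: creates_def)
      ultimately show ?thesis
        using created_inner[OF PQ] well_formed_arc[OF pos_diagram_well_formed[OF g(1)], of l] p(4) inc(1,5)
        by auto
    qed
    have "tail ?T e \<in> ?A \<and> head ?T e \<in> ?B \<or> tail ?T e \<in> ?B \<and> head ?T e \<in> ?A" if "e \<in> arcs ?T" for e
    proof -
      from that consider a l r where "e = (l, Upper)" "([a], [l, r]) \<in> cells P"
        | a l r where "e = (l, Lower)" "([a], [l, r]) \<in> cells Q" unfolding arcs by blast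
      then show ?thesis
      proof cases
        case 1
        then show ?thesis using flip[OF PQ x 1(2)] by (auto simp: T)
      next
        case 2
        then show ?thesis using flip[OF glueable_sym[OF PQ] y 2(2)] par g(5,6,9,11) by (auto simp: T)
      qed
    qed
    moreover have "?A \<union> ?B = verts ?T" "?A \<inter> ?B = {}" by auto
    ultimately show "bipartite ?T" unfolding bipartite_def by blast
  qed
qed

lemma standard_chain_of_walk:
  assumes "pre_digraph.cas G u p v" "p \<noteq> []"
    and "\<And>e. e \<in> set p \<Longrightarrow> standard_interval (x (tail G e)) (x (head G e)) \<and>
      standard_interval (y (tail G e)) (y (head G e)) \<and>
      affine_piece g (x (tail G e)) (x (head G e)) (y (tail G e)) (y (head G e))"
  shows "standard_chain g (insert (x u) (x ` head G ` set p)) (x u) (x v) (y u) (y v)"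
  using assms
proof (induction p arbitrary: u)
  case (Cons e p)
  have u: "tail G e = u" and walk: "pre_digraph.cas G (head G e) p v"
    using Cons.prems(1) by (auto simp: pre_digraph.cas.simps)
  have e: "standard_interval (x u) (x (head G e))" "standard_interval (y u) (y (head G e))"
    "affine_piece g (x u) (x (head G e)) (y u) (y (head G e))"
    using Cons.prems(3)[of e] u by auto
  show ?case
  proof (cases "p = []")
    case True
    then show ?thesis using standard_chain.single[OF e] walk by (simp add: pre_digraph.cas.simps)
  next
    case False
    have "standard_chain g (insert (x (head G e)) (x ` head G ` set p)) (x (head G e)) (x v) (y (head G e)) (y v)"
      using Cons.IH[OF walk False] Cons.prems(3) by simp
    from standard_chain.cons[OF e this] show ?thesis by simp
  qed
qed simp

lemma glue_standard_chain:
  assumes PQ: "glueable P Q" and x: "unit_positions P x" and y: "unit_positions Q y"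
    and affine: "\<And>e. e \<in> set (bot_path P) \<Longrightarrow>
      affine_piece g (x (tail (graph P) e)) (x (head (graph P) e)) (y (tail (graph P) e)) (y (head (graph P) e))"
  shows "standard_chain g (x ` verts (graph P)) 0 1 0 1" "\<And>v. v \<in> verts (graph P) \<Longrightarrow> g (x v) = y v"
proof -
  note g = glueableD[OF PQ] and wf = pos_diagram_well_formed[OF glueableD(1)[OF PQ]]
  have walk: "pre_digraph.cas (graph P) (init_vertex P) (bot_path P) (term_vertex P)"
    using wf by (simp add: well_formed_def)
  have init: "tail (graph P) (hd (bot_path P)) = init_vertex P"
    by (rule cas_tail_hd[OF walk well_formed_paths(2)[OF wf]])
  have std: "standard_interval (x (tail (graph P) e)) (x (head (graph P) e)) \<and>
      standard_interval (y (tail (graph P) e)) (y (head (graph P) e))" if "e \<in> set (bot_path P)" for e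
    using that arc_standard[OF g(1,3) x, of e] arc_standard[OF g(2,4) y, of e] g(5,6,8) by auto
  have V: "verts (graph P) = insert (init_vertex P) (head (graph P) ` set (bot_path P))"
    using pos_diagram_verts_bot[OF g(1)] init by (simp add: path_verts_def)
  have "standard_chain g (insert (x (init_vertex P)) (x ` head (graph P) ` set (bot_path P)))
      (x (init_vertex P)) (x (term_vertex P)) (y (init_vertex P)) (y (term_vertex P))"
    using std affine by (intro standard_chain_of_walk[OF walk well_formed_paths(2)[OF wf]]) auto
  then show "standard_chain g (x ` verts (graph P)) 0 1 0 1"
    using x y g(10,11) by (simp add: V unit_positions_def)
  have e: "g (x (tail (graph P) e)) = y (tail (graph P) e)" "g (x (head (graph P) e)) = y (head (graph P) e)"
    if "e \<in> set (bot_path P)" for e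
    using affine_piece_ends[OF affine[OF that]] std[OF that] standard_interval_bounds(2) by blast+
  have "hd (bot_path P) \<in> set (bot_path P)" using well_formed_paths(2)[OF wf] by simp
  from e(1)[OF this] e(2) show "g (x v) = y v" if "v \<in> verts (graph P)" for v
    using that unfolding V init by blast
qed

text \<open>The condition of \<^const>\<open>represents\<close> on the function, for a diagram that is given by its halves.\<close>
definition pair_map :: "diagram \<Rightarrow> diagram \<Rightarrow> (real \<Rightarrow> real) \<Rightarrow> bool" where
  "pair_map P Q g \<longleftrightarrow> (\<forall>e\<in>set (bot_path P). \<exists>a b c d.
     edge_interval P e a b \<and> edge_interval Q e c d \<and> affine_piece g a b c d) \<and>
     (\<forall>x. x \<notin> {0..1} \<longrightarrow> g x = x)"

lemma bipartite_iff_stabilizer: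
  assumes PQ: "glueable P Q" and g: "pair_map P Q g"
  shows "bipartite (thompson_graph (dmult P (dinv Q))) \<longleftrightarrow> g \<in> stabilizer_F odd_digit_sum_dyadics"
proof -
  note gl = glueableD[OF PQ]
  obtain x where x: "unit_positions P x" using unit_positions_exist[OF gl(1,3)] by blast
  obtain y where y: "unit_positions Q y" using unit_positions_exist[OF gl(2,4)] by blast
  have "affine_piece g (x (tail (graph P) e)) (x (head (graph P) e)) (y (tail (graph P) e)) (y (head (graph P) e))"
    if e: "e \<in> set (bot_path P)" for e
  proof -
    obtain a b c d where "edge_interval P e a b" "edge_interval Q e c d" "affine_piece g a b c d"
      using g e unfolding pair_map_def by blast
    then show ?thesis
      using edge_interval_positions[OF gl(1,3) x, of e a b] edge_interval_positions[OF gl(2,4) y, of e c d]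
        gl(5,6) by simp
  qed
  note chain = glue_standard_chain[OF PQ x y this]
  show ?thesis
    using bipartite_thompson_graph_iff[OF PQ x y] standard_chain_stabilizer_iff[OF chain(1)] chain(2) g
    by (simp add: pair_map_def)
qed

text \<open>The cells of each half have one sign, so by \<open>is_diagram_one_sign\<close> the upper half and the mirror
  image of the lower half are positive diagrams.\<close>
lemma represents_pair:
  assumes "diagram_in_F D" "represents D g"
  obtains P Q where "D = dmult P (dinv Q)" "glueable P Q" "pair_map P Q g"
proof -
  from assms(2) obtain P N where PN: "is_diagram P" "is_diagram N" "multipliable P N" "D = dmult P N"
    "\<forall>c\<in>cells P. pi_cell c" "\<forall>c\<in>cells N. pi_inv_cell c"
    and g: "\<forall>e\<in>set (bot_path P). \<exists>a b c d. edge_interval P e a b \<and> edge_interval (dinv N) e c d \<and>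
           (\<forall>x\<in>{a..b}. g x = c + (d - c) / (b - a) * (x - a))" "\<forall>x. x \<notin> {0..1} \<longrightarrow> g x = x"
    unfolding represents_def by blast
  have "glueable P (dinv N)"
    using PN assms(1) is_diagram_one_sign[of P] is_diagram_one_sign[of N]
    by (auto simp: glueable_def diagram_in_F_def)
  moreover have "pair_map P (dinv N) g" using g by (simp add: pair_map_def affine_piece_def)
  ultimately show thesis using that[of P "dinv N"] PN(4) by simp
qed

section \<open>Binary trees and their diagrams\<close>

datatype bintree = Leaf | Caret bintree bintree

primrec leaf_count :: "bintree \<Rightarrow> nat" where
  "leaf_count Leaf = 1"
| "leaf_count (Caret t u) = leaf_count t + leaf_count u"

primrec leaf_intervals :: "bintree \<Rightarrow> real \<Rightarrow> real \<Rightarrow> (real \<times> real) list" where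
  "leaf_intervals Leaf a b = [(a, b)]"
| "leaf_intervals (Caret t u) a b = leaf_intervals t a ((a + b) / 2) @ leaf_intervals u ((a + b) / 2) b"

lemma leaf_count_pos [simp]: "0 < leaf_count t"
  by (induction t) simp_all

lemma length_leaf_intervals [simp]: "length (leaf_intervals t a b) = leaf_count t"
  by (induction t arbitrary: a b) simp_all

lemma leaf_intervals_nonempty:
  "a < b \<Longrightarrow> (c, d) \<in> set (leaf_intervals t a b) \<Longrightarrow> c < d"
proof (induction t arbitrary: a b)
  case (Caret t u)
  have m: "a < (a + b) / 2" "(a + b) / 2 < b" using Caret.prems(1) by simp_all
  show ?case using Caret.prems(2) Caret.IH(1)[OF m(1)] Caret.IH(2)[OF m(2)] by auto
qed simp

text \<open>In the diagram of a pair of trees, the vertices are numbered from left to right and an edge from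
  vertex \<open>i\<close> to vertex \<open>j\<close> carries these numbers in its name.  The tag \<open>s\<close> tells apart the inner edges of
  the two trees, which may join the same vertices; leaves get the tag 2 in both trees, so that
  the leaves of the two trees are the same edges.\<close>
definition edge_name :: "nat \<Rightarrow> nat \<Rightarrow> nat \<Rightarrow> nat" where
  "edge_name s i j = prod_encode (s, prod_encode (i, j))"

lemma edge_name_eq_iff [simp]: "edge_name s i j = edge_name s' i' j' \<longleftrightarrow> s = s' \<and> i = i' \<and> j = j'"
  by (simp add: edge_name_def)

text \<open>The incidence functions do not depend on the vertex and edge sets, so all these graphs are
  compatible and gluing is plain union.\<close>
definition named_graph :: "nat set \<Rightarrow> nat set \<Rightarrow> (nat, nat) pre_digraph" where
  "named_graph V E = \<lparr>verts = V, arcs = E,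
     tail = (\<lambda>e. fst (prod_decode (snd (prod_decode e)))),
     head = (\<lambda>e. snd (prod_decode (snd (prod_decode e))))\<rparr>"

lemma named_graph_simps [simp]:
  "verts (named_graph V E) = V" "arcs (named_graph V E) = E"
  "tail (named_graph V E) (edge_name s i j) = i" "head (named_graph V E) (edge_name s i j) = j"
  by (simp_all add: named_graph_def edge_name_def)

lemma named_graph_compatible [simp]: "compatible (named_graph V E) (named_graph V' E')"
  by (simp add: named_graph_def compatible_def)

lemma named_graph_union: "union (named_graph V E) (named_graph V' E') = named_graph (V \<union> V') (E \<union> E')"
  by (simp add: named_graph_def union_def)

definition tree_edge :: "nat \<Rightarrow> bintree \<Rightarrow> nat \<Rightarrow> nat" where
  "tree_edge s t i = edge_name (if t = Leaf then 2 else s) i (i + leaf_count t)"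

primrec tree_arcs :: "nat \<Rightarrow> bintree \<Rightarrow> nat \<Rightarrow> nat set" where
  "tree_arcs s Leaf i = {tree_edge s Leaf i}"
| "tree_arcs s (Caret t u) i =
     insert (tree_edge s (Caret t u) i) (tree_arcs s t i \<union> tree_arcs s u (i + leaf_count t))"

primrec tree_cells :: "nat \<Rightarrow> bintree \<Rightarrow> nat \<Rightarrow> (nat list \<times> nat list) set" where
  "tree_cells s Leaf i = {}"
| "tree_cells s (Caret t u) i =
     insert ([tree_edge s (Caret t u) i], [tree_edge s t i, tree_edge s u (i + leaf_count t)])
       (tree_cells s t i \<union> tree_cells s u (i + leaf_count t))"

definition tree_diagram :: "nat \<Rightarrow> bintree \<Rightarrow> nat \<Rightarrow> diagram" where
  "tree_diagram s t i = \<lparr>graph = named_graph {i..i + leaf_count t} (tree_arcs s t i),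
     top_path = [tree_edge s t i],
     bot_path = map (\<lambda>j. edge_name 2 j (Suc j)) [i..<i + leaf_count t],
     cells = tree_cells s t i\<rparr>"

lemma tree_diagram_simps [simp]:
  "graph (tree_diagram s t i) = named_graph {i..i + leaf_count t} (tree_arcs s t i)"
  "top_path (tree_diagram s t i) = [tree_edge s t i]"
  "bot_path (tree_diagram s t i) = map (\<lambda>j. edge_name 2 j (Suc j)) [i..<i + leaf_count t]"
  "cells (tree_diagram s t i) = tree_cells s t i"
  by (simp_all add: tree_diagram_def)

lemma tree_edge_ends [simp]:
  "tail (named_graph V E) (tree_edge s t i) = i"
  "head (named_graph V E) (tree_edge s t i) = i + leaf_count t"
  by (simp_all add: tree_edge_def)

lemma tree_diagram_ends [simp]:
  "init_vertex (tree_diagram s t i) = i" "term_vertex (tree_diagram s t i) = i + leaf_count t"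
  by (simp_all add: init_vertex_def term_vertex_def)

lemma tree_edge_in_arcs [simp]: "tree_edge s t i \<in> tree_arcs s t i"
  by (cases t) simp_all

lemma tree_arcsE:
  assumes "e \<in> tree_arcs s t i"
  obtains k a b where "e = edge_name k a b" "i \<le> a" "a < b" "b \<le> i + leaf_count t"
    "k = s \<or> k = 2 \<and> b = Suc a"
proof -
  have "\<exists>k a b. e = edge_name k a b \<and> i \<le> a \<and> a < b \<and> b \<le> i + leaf_count t \<and>
      (k = s \<or> k = 2 \<and> b = Suc a)"
    using assms
  proof (induction t arbitrary: i)
    case Leaf
    then show ?case by (simp add: tree_edge_def)
  next
    case (Caret t u)
    then consider "e = tree_edge s (Caret t u) i" | "e \<in> tree_arcs s t i"
      | "e \<in> tree_arcs s u (i + leaf_count t)" by auto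
    then show ?case
    proof cases
      case 1
      then show ?thesis
        by (intro exI[of _ s] exI[of _ i] exI[of _ "i + leaf_count (Caret t u)"])
          (simp add: tree_edge_def)
    next
      case 2
      then show ?thesis using Caret.IH(1)[OF 2] by fastforce
    next
      case 3
      then show ?thesis using Caret.IH(2)[OF 3] by fastforce
    qed
  qed
  then show thesis using that by blast
qed

lemma leaf_edge_in_arcs:
  "i \<le> j \<Longrightarrow> j < i + leaf_count t \<Longrightarrow> edge_name 2 j (Suc j) \<in> tree_arcs s t i"
proof (induction t arbitrary: i)
  case Leaf
  then show ?case by (simp add: tree_edge_def)
next
  case (Caret t u)
  then show ?case by (cases "j < i + leaf_count t") auto
qed

text \<open>The diagram of a tree \<open>Caret t u\<close> is one cell \<open>\<pi>\<close>, multiplied by the sum of the diagrams of \<open>t\<close> and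
  \<open>u\<close>.\<close>
lemma pos_diagram_tree: "pos_diagram (tree_diagram s t i)"
proof (induction t arbitrary: i)
  case Leaf
  have "edge_diagram (tree_diagram s Leaf i)"
    unfolding edge_diagram_def
    by (rule exI[of _ i], rule exI[of _ "Suc i"], rule exI[of _ "tree_edge s Leaf i"])
      (auto simp: tree_edge_def)
  then show ?case by (rule pos_diagram.edge)
next
  case (Caret t u)
  let ?m = "i + leaf_count t" and ?n = "i + leaf_count t + leaf_count u"
  let ?e = "tree_edge s (Caret t u) i" and ?l = "tree_edge s t i" and ?r = "tree_edge s u ?m"
  define C where "C = \<lparr>graph = named_graph {i, ?m, ?n} {?e, ?l, ?r}, top_path = [?e],
    bot_path = [?l, ?r], cells = {([?e], [?l, ?r])}\<rparr>"
  define E where "E = dadd (tree_diagram s t i) (tree_diagram s u ?m)"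
  have ne: "?e \<notin> tree_arcs s t i" "?e \<notin> tree_arcs s u ?m"
    by (auto simp: tree_edge_def elim!: tree_arcsE)
      (use leaf_count_pos[of t] leaf_count_pos[of u] in linarith)+
  have disj: "tree_arcs s t i \<inter> tree_arcs s u ?m = {}"
    by (fastforce elim!: tree_arcsE)
  have "pi_diagram C"
    unfolding pi_diagram_def
    by (rule exI[of _ i], rule exI[of _ ?m], rule exI[of _ ?n], rule exI[of _ ?e],
        rule exI[of _ ?l], rule exI[of _ ?r])
      (auto simp: C_def tree_edge_def)
  then have C: "pos_diagram C" by (rule pos_diagram.cell)
  have "addable (tree_diagram s t i) (tree_diagram s u ?m)"
    using disj by (auto simp: addable_def)
  then have E: "pos_diagram E" unfolding E_def using Caret.IH by (intro pos_diagram.add)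
  have gE: "graph E = named_graph {i..?n} (tree_arcs s t i \<union> tree_arcs s u ?m)"
    "top_path E = [?l, ?r]" "bot_path E = map (\<lambda>j. edge_name 2 j (Suc j)) [i..<?n]"
    "cells E = tree_cells s t i \<union> tree_cells s u ?m"
  proof -
    have "{i..?m} \<union> {?m..?n} = {i..?n}" by auto
    then show "graph E = named_graph {i..?n} (tree_arcs s t i \<union> tree_arcs s u ?m)"
      by (simp add: E_def dadd_def named_graph_union)
    have "[i..<?n] = [i..<?m] @ [?m..<?n]" by (rule upt_add_eq_append) simp
    then show "bot_path E = map (\<lambda>j. edge_name 2 j (Suc j)) [i..<?n]" by (simp add: E_def)
  qed (simp_all add: E_def)
  have "multipliable C E"
    using ne by (auto simp: multipliable_def gE C_def init_vertex_def pre_digraph.awalk_verts.simps)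
  then have "pos_diagram (dmult C E)" using C E by (intro pos_diagram.mult)
  moreover have "dmult C E = tree_diagram s (Caret t u) i"
  proof -
    have "{i, ?m, ?n} \<union> {i..?n} = {i..?n}" "{?e, ?l, ?r} \<union> (tree_arcs s t i \<union> tree_arcs s u ?m) =
        tree_arcs s (Caret t u) i" by auto
    then have "union (graph C) (graph E) = graph (tree_diagram s (Caret t u) i)"
      by (simp add: C_def gE named_graph_union add.assoc)
    then show ?thesis unfolding dmult_def
      by (simp add: C_def gE tree_diagram_def add.assoc)
  qed
  ultimately show ?case by simp
qed

lemma glueable_trees:
  assumes "leaf_count t = leaf_count u"
  shows "glueable (tree_diagram 0 t 0) (tree_diagram 1 u 0)"
proof -
  let ?n = "leaf_count t"
  let ?leaves = "(\<lambda>j. edge_name 2 j (Suc j)) ` {0..<?n}"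
  have "tree_arcs 0 t 0 \<inter> tree_arcs 1 u 0 = ?leaves"
  proof (intro equalityI subsetI)
    fix e assume e: "e \<in> tree_arcs 0 t 0 \<inter> tree_arcs 1 u 0"
    obtain k a b where 1: "e = edge_name k a b" "b \<le> 0 + ?n" "k = 0 \<or> k = 2 \<and> b = Suc a"
      using e by (blast elim: tree_arcsE)
    obtain k' a' b' where 2: "e = edge_name k' a' b'" "k' = 1 \<or> k' = 2 \<and> b' = Suc a'"
      using e by (blast elim: tree_arcsE)
    from 1 2 show "e \<in> ?leaves" by auto
  qed (use assms in \<open>auto intro!: leaf_edge_in_arcs\<close>)
  moreover have "set (pre_digraph.awalk_verts (graph (tree_diagram 0 t 0)) 0 (bot_path (tree_diagram 0 t 0))) =
      {0..?n}"
    using path_verts_walk(1)[OF pos_diagram_well_formed[OF pos_diagram_tree[of 0 t 0]]]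
      pos_diagram_verts_bot[OF pos_diagram_tree[of 0 t 0]] by simp
  ultimately have "multipliable (tree_diagram 0 t 0) (dinv (tree_diagram 1 u 0))"
    using assms by (simp add: multipliable_def)
  then show ?thesis by (simp add: glueable_def pos_diagram_tree)
qed

lemma tree_edge_intervals:
  assumes "tree_cells s t i \<subseteq> cells D" "edge_interval D (tree_edge s t i) a b" "j < leaf_count t"
  shows "edge_interval D (edge_name 2 (i + j) (Suc (i + j)))
    (fst (leaf_intervals t a b ! j)) (snd (leaf_intervals t a b ! j))"
  using assms
proof (induction t arbitrary: i a b j)
  case Leaf
  then show ?case by (simp add: tree_edge_def)
next
  case (Caret t u)
  have c: "([tree_edge s (Caret t u) i], [tree_edge s t i, tree_edge s u (i + leaf_count t)]) \<in> cells D"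
    using Caret.prems(1) by simp
  note l = edge_interval.left[OF Caret.prems(2) c] and r = edge_interval.right[OF Caret.prems(2) c]
  show ?case
  proof (cases "j < leaf_count t")
    case True
    then show ?thesis using Caret.IH(1)[OF _ l True] Caret.prems(1) by (simp add: nth_append)
  next
    case False
    then show ?thesis using Caret.IH(2)[OF _ r, of "j - leaf_count t"] Caret.prems(1,3)
      by (simp add: nth_append)
  qed
qed

definition tree_pair_map :: "bintree \<Rightarrow> bintree \<Rightarrow> (real \<Rightarrow> real) \<Rightarrow> bool" where
  "tree_pair_map t u g \<longleftrightarrow>
     list_all2 (\<lambda>(a, b) (c, d). affine_piece g a b c d) (leaf_intervals t 0 1) (leaf_intervals u 0 1)"

lemma tree_pair_map_leaf_count: "tree_pair_map t u g \<Longrightarrow> leaf_count t = leaf_count u"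
  by (metis tree_pair_map_def list_all2_lengthD length_leaf_intervals)

lemma tree_pair_map_diagrams:
  assumes "tree_pair_map t u g" "\<forall>x. x \<notin> {0..1} \<longrightarrow> g x = x"
  shows "pair_map (tree_diagram 0 t 0) (tree_diagram 1 u 0) g"
  unfolding pair_map_def
proof (intro conjI ballI)
  fix e assume "e \<in> set (bot_path (tree_diagram 0 t 0))"
  then obtain j where j: "j < leaf_count t" "e = edge_name 2 j (Suc j)" by auto
  have top: "edge_interval (tree_diagram s v 0) (tree_edge s v 0) 0 1" for s v
    by (rule edge_interval.top) simp
  have "affine_piece g (fst (leaf_intervals t 0 1 ! j)) (snd (leaf_intervals t 0 1 ! j))
      (fst (leaf_intervals u 0 1 ! j)) (snd (leaf_intervals u 0 1 ! j))"
    using assms(1) j(1) list_all2_nthD[of _ "leaf_intervals t 0 1" _ j]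
    by (fastforce simp: tree_pair_map_def split_beta)
  moreover have "edge_interval (tree_diagram 0 t 0) e
      (fst (leaf_intervals t 0 1 ! j)) (snd (leaf_intervals t 0 1 ! j))"
    using tree_edge_intervals[of 0 t 0 "tree_diagram 0 t 0" 0 1 j] top[of 0 t] j by simp
  moreover have "edge_interval (tree_diagram 1 u 0) e
      (fst (leaf_intervals u 0 1 ! j)) (snd (leaf_intervals u 0 1 ! j))"
    using tree_edge_intervals[of 1 u 0 "tree_diagram 1 u 0" 0 1 j] top[of 1 u] j tree_pair_map_leaf_count[OF assms(1)] by simp
  ultimately show "\<exists>a b c d. edge_interval (tree_diagram 0 t 0) e a b \<and>
      edge_interval (tree_diagram 1 u 0) e c d \<and> affine_piece g a b c d" by blast
qed (use assms(2) in blast)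

text \<open>As edges go from smaller to greater numbers, no walk from vertex 0 to vertex \<open>n\<close> is longer than the
  bottom path of the trees, which visits every vertex.\<close>
lemma increasing_walk_length:
  assumes "pre_digraph.cas G u p v" "\<forall>e\<in>set p. tail G e < (head G e :: nat)"
  shows "u + length p \<le> v"
  using assms by (induction p arbitrary: u) (fastforce simp: pre_digraph.cas.simps)+

lemma trees_represent:
  assumes "tree_pair_map t u g" "\<forall>x. x \<notin> {0..1} \<longrightarrow> g x = x"
  defines "D \<equiv> dmult (tree_diagram 0 t 0) (dinv (tree_diagram 1 u 0))"
  shows "diagram_in_F D" "represents D g"
proof -
  let ?P = "tree_diagram 0 t 0" and ?Q = "tree_diagram 1 u 0"
  have n: "leaf_count t = leaf_count u" by (rule tree_pair_map_leaf_count[OF assms(1)])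
  note gl = glueable_trees[OF n]
  have m: "multipliable ?P (dinv ?Q)" using gl by (simp add: glueable_def)
  have P: "is_diagram ?P" and N: "is_diagram (dinv ?Q)"
    by (intro is_diagram.inv pos_diagram_is_diagram pos_diagram_tree)+
  then show "diagram_in_F D" using is_diagram.mult[OF P N m] by (simp add: diagram_in_F_def D_def)
  note wfP = is_diagram_well_formed[OF P] and wfN = is_diagram_well_formed[OF N]
  have ends: "init_vertex D = 0" "term_vertex D = leaf_count t"
    using dmult_ends[OF wfP wfN m] by (simp_all add: D_def)
  have inc: "tail (graph D) e < head (graph D) e" if "e \<in> arcs (graph D)" for e
    using that unfolding D_def by (auto elim!: tree_arcsE)
  have cas: "pre_digraph.cas (graph D) = pre_digraph.cas (graph ?P)"
    by (rule compatible_cas) (simp add: D_def compatible_def)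
  have "pre_digraph.cas (graph D) 0 (bot_path ?P) (leaf_count t)"
    unfolding cas using wfP by (simp add: well_formed_def)
  then have "pre_digraph.awalk (graph D) 0 (bot_path ?P) (leaf_count t)"
    using well_formed_paths(4)[OF wfP] by (auto simp: pre_digraph.awalk_def D_def)
  moreover have "length q \<le> leaf_count t" if "pre_digraph.awalk (graph D) 0 q (leaf_count t)" for q
    using increasing_walk_length[of "graph D" 0 q "leaf_count t"] that inc
    by (auto simp: pre_digraph.awalk_def)
  ultimately have longest: "longest_positive_path D (bot_path ?P)"
    by (simp add: longest_positive_path_def ends)
  have cells: "pi_cell c" if "c \<in> cells (tree_diagram s v i)" for c s v i
    by (rule pos_diagram_cell[OF pos_diagram_tree that]) (simp add: pi_cell_def)
  have "pi_inv_cell (prod.swap c)" if "c \<in> cells ?Q" for c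
    using cells[OF that] by (simp add: pi_cell_def pi_inv_cell_def)
  then have "\<forall>c\<in>cells (dinv ?Q). pi_inv_cell c" by auto
  moreover have "\<forall>c\<in>cells ?P. pi_cell c" using cells by blast
  moreover note tree_pair_map_diagrams[OF assms(1,2)]
  ultimately show "represents D g"
    unfolding represents_def
    by (intro conjI exI[of _ ?P] exI[of _ "dinv ?Q"])
      (use P N m longest in \<open>simp_all add: D_def pair_map_def affine_piece_def del: tree_diagram_simps dinv_simps(2-)\<close>)
qed

section \<open>Reduced tree pairs\<close>

text \<open>A cell whose bottom edges both carry the tag 2 is a caret with two leaves.  Replacing it by a leaf
  merges two neighbouring leaf intervals, at a place in the list that depends only on the number \<open>j\<close>
  of its left vertex.  For two trees with the same caret, the merged intervals therefore
  correspond to each other.\<close>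
lemma prune_caret:
  assumes "([e], [edge_name 2 j j', edge_name 2 k k']) \<in> tree_cells s t i" "s \<noteq> 2"
  shows "\<exists>t'. leaf_count t = Suc (leaf_count t') \<and> (\<forall>a b. \<exists>xs c d ys.
    leaf_intervals t a b = xs @ [(c, (c + d) / 2), ((c + d) / 2, d)] @ ys \<and>
    leaf_intervals t' a b = xs @ [(c, d)] @ ys \<and> i + length xs = j)"
  using assms
proof (induction t arbitrary: i)
  case Leaf
  then show ?case by simp
next
  case (Caret t u)
  then consider "t = Leaf" "u = Leaf" "i = j"
    | "([e], [edge_name 2 j j', edge_name 2 k k']) \<in> tree_cells s t i"
    | "([e], [edge_name 2 j j', edge_name 2 k k']) \<in> tree_cells s u (i + leaf_count t)"
    by (auto simp: tree_edge_def split: if_splits)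
  then show ?case
  proof cases
    case 1
    show ?thesis
      by (rule exI[of _ Leaf]) (use 1 in \<open>auto intro!: exI[of _ "[]"]\<close>)
  next
    case 2
    obtain t' where t': "leaf_count t = Suc (leaf_count t')" "\<And>a b. \<exists>xs c d ys.
      leaf_intervals t a b = xs @ [(c, (c + d) / 2), ((c + d) / 2, d)] @ ys \<and>
      leaf_intervals t' a b = xs @ [(c, d)] @ ys \<and> i + length xs = j"
      using Caret.IH(1)[OF 2 Caret.prems(2)] by blast
    have "\<exists>xs c d ys. leaf_intervals (Caret t u) a b = xs @ [(c, (c + d) / 2), ((c + d) / 2, d)] @ ys \<and>
      leaf_intervals (Caret t' u) a b = xs @ [(c, d)] @ ys \<and> i + length xs = j" for a b
    proof -
      obtain xs c d ys where "leaf_intervals t a ((a + b) / 2) = xs @ [(c, (c + d) / 2), ((c + d) / 2, d)] @ ys"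
        "leaf_intervals t' a ((a + b) / 2) = xs @ [(c, d)] @ ys" "i + length xs = j"
        using t'(2) by blast
      then show ?thesis
        by (intro exI[of _ xs] exI[of _ c] exI[of _ d] exI[of _ "ys @ leaf_intervals u ((a + b) / 2) b"]) simp
    qed
    then show ?thesis using t'(1) by (intro exI[of _ "Caret t' u"]) simp
  next
    case 3
    obtain u' where u': "leaf_count u = Suc (leaf_count u')" "\<And>a b. \<exists>xs c d ys.
      leaf_intervals u a b = xs @ [(c, (c + d) / 2), ((c + d) / 2, d)] @ ys \<and>
      leaf_intervals u' a b = xs @ [(c, d)] @ ys \<and> i + leaf_count t + length xs = j"
      using Caret.IH(2)[OF 3 Caret.prems(2)] by blast
    have "\<exists>xs c d ys. leaf_intervals (Caret t u) a b = xs @ [(c, (c + d) / 2), ((c + d) / 2, d)] @ ys \<and>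
      leaf_intervals (Caret t u') a b = xs @ [(c, d)] @ ys \<and> i + length xs = j" for a b
    proof -
      obtain xs c d ys where "leaf_intervals u ((a + b) / 2) b = xs @ [(c, (c + d) / 2), ((c + d) / 2, d)] @ ys"
        "leaf_intervals u' ((a + b) / 2) b = xs @ [(c, d)] @ ys" "i + leaf_count t + length xs = j"
        using u'(2) by blast
      then show ?thesis
        by (intro exI[of _ "leaf_intervals t a ((a + b) / 2) @ xs"] exI[of _ c] exI[of _ d] exI[of _ ys]) simp
    qed
    then show ?thesis using u'(1) by (intro exI[of _ "Caret t u'"]) simp
  qed
qed

lemma affine_piece_merge:
  assumes "affine_piece g a ((a + b) / 2) c ((c + d) / 2)" "affine_piece g ((a + b) / 2) b ((c + d) / 2) d"
    and "a < b"
  shows "affine_piece g a b c d"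
  unfolding affine_piece_def
proof
  fix x assume x: "x \<in> {a..b}"
  have slopes: "((c + d) / 2 - c) / ((a + b) / 2 - a) = (d - c) / (b - a)"
    "(d - (c + d) / 2) / (b - (a + b) / 2) = (d - c) / (b - a)"
    using assms(3) by (simp_all add: divide_simps) (simp_all add: algebra_simps)
  show "g x = c + (d - c) / (b - a) * (x - a)"
  proof (cases "x \<le> (a + b) / 2")
    case True
    then show ?thesis using assms(1) x unfolding affine_piece_def slopes by simp
  next
    case False
    then have "g x = (c + d) / 2 + (d - c) / (b - a) * (x - (a + b) / 2)"
      using assms(2) x unfolding affine_piece_def slopes by simp
    also have "\<dots> = c + (d - c) / (b - a) * (x - a)" using assms(3) by (simp add: field_simps)
    finally show ?thesis .
  qed
qed

text \<open>A dipole of the form \<open>\<pi> \<circ> \<pi>\<inverse>\<close> is a common caret of the two trees, which can be pruned from both.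
  There is no dipole of the form \<open>\<pi>\<inverse> \<circ> \<pi>\<close>: its middle edge would be shared by both trees, hence a leaf,
  and at the same time the top edge of a cell.\<close>
lemma reduced_tree_pair_exists:
  assumes "tree_pair_map t u g"
  shows "\<exists>t u. tree_pair_map t u g \<and> reduced (dmult (tree_diagram 0 t 0) (dinv (tree_diagram 1 u 0)))"
  using assms
proof (induction "leaf_count t" arbitrary: t u rule: less_induct)
  case less
  let ?P = "tree_diagram 0 t 0" and ?Q = "tree_diagram 1 u 0"
  note n = tree_pair_map_leaf_count[OF less.prems]
  note gl = glueableD[OF glueable_trees[OF n]]
  show ?case
  proof (cases "reduced (dmult ?P (dinv ?Q))")
    case True
    then show ?thesis using less.prems by blast
  next
    case False
    then obtain c c' where cc: "c \<in> cells ?P \<union> prod.swap ` cells ?Q" "c' \<in> cells ?P \<union> prod.swap ` cells ?Q"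
      "snd c = fst c'" "pi_cell c \<and> pi_inv_cell c' \<or> pi_inv_cell c \<and> pi_cell c'"
      unfolding reduced_def dipole_def dmult_simps dinv_simps by blast
    have P: "\<exists>e l r. c = ([e], [l, r]) \<and> {e, l, r} \<subseteq> arcs (graph ?P)" if "c \<in> cells ?P" for c
      by (rule pos_diagram_cell[OF gl(1) that]) blast
    have Q: "\<exists>e l r. c = ([e], [l, r]) \<and> {e, l, r} \<subseteq> arcs (graph ?Q)" if "c \<in> cells ?Q" for c
      by (rule pos_diagram_cell[OF gl(2) that]) blast
    have Q': "\<exists>e l r. c = ([l, r], [e]) \<and> ([e], [l, r]) \<in> cells ?Q \<and> {e, l, r} \<subseteq> arcs (graph ?Q)"
      if "c \<in> prod.swap ` cells ?Q" for c
      using that Q by force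
    have "\<not> pi_inv_cell c" if "c \<in> cells ?P" for c
      using P[OF that] by (auto simp: pi_inv_cell_def)
    moreover have "\<not> pi_cell c" if "c \<in> prod.swap ` cells ?Q" for c
      using Q'[OF that] by (auto simp: pi_cell_def)
    ultimately consider "c \<in> cells ?P" "c' \<in> prod.swap ` cells ?Q"
      | "c \<in> prod.swap ` cells ?Q" "c' \<in> cells ?P"
      using cc(1,2,4) by blast
    then show ?thesis
    proof cases
      case 1
      obtain e l r where c: "([e], [l, r]) \<in> cells ?P" "c = ([e], [l, r])" "{l, r} \<subseteq> arcs (graph ?P)"
        using P 1(1) by blast
      obtain e' where c': "([e'], [l, r]) \<in> cells ?Q" "{l, r} \<subseteq> arcs (graph ?Q)"
        using Q'[OF 1(2)] c(2) cc(3) by auto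
      have "{l, r} \<subseteq> set (bot_path ?P)" using c(3) c'(2) gl(8) by blast
      then obtain j k where jk: "l = edge_name 2 j (Suc j)" "r = edge_name 2 k (Suc k)" by auto
      have "([e], [edge_name 2 j (Suc j), edge_name 2 k (Suc k)]) \<in> tree_cells 0 t 0"
        "([e'], [edge_name 2 j (Suc j), edge_name 2 k (Suc k)]) \<in> tree_cells 1 u 0"
        using c(1) c'(1) jk by simp_all
      note prune = prune_caret[OF this(1)] prune_caret[OF this(2)]
      obtain t' where t': "leaf_count t = Suc (leaf_count t')" "\<exists>xs c d ys.
          leaf_intervals t 0 1 = xs @ [(c, (c + d) / 2), ((c + d) / 2, d)] @ ys \<and>
          leaf_intervals t' 0 1 = xs @ [(c, d)] @ ys \<and> 0 + length xs = j"
        using prune(1) by (metis zero_neq_numeral)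
      obtain u' where u': "\<exists>xs c d ys.
          leaf_intervals u 0 1 = xs @ [(c, (c + d) / 2), ((c + d) / 2, d)] @ ys \<and>
          leaf_intervals u' 0 1 = xs @ [(c, d)] @ ys \<and> 0 + length xs = j"
        using prune(2) by (metis numeral_One numeral_eq_iff semiring_norm(85))
      from t'(2) obtain xs a b ys where x: "leaf_intervals t 0 1 = xs @ [(a, (a + b) / 2), ((a + b) / 2, b)] @ ys"
        "leaf_intervals t' 0 1 = xs @ [(a, b)] @ ys" "length xs = j" by auto
      from u' obtain xs' c d ys' where y: "leaf_intervals u 0 1 = xs' @ [(c, (c + d) / 2), ((c + d) / 2, d)] @ ys'"
        "leaf_intervals u' 0 1 = xs' @ [(c, d)] @ ys'" "length xs' = j" by auto
      have "a < b" using leaf_intervals_nonempty[of 0 1 a b t'] x(2) by simp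
      then have "tree_pair_map t' u' g"
        using less.prems x(3) y(3) unfolding tree_pair_map_def x(1,2) y(1,2)
        by (auto simp: list_all2_append intro: affine_piece_merge)
      then show ?thesis by (intro less.hyps[of t' u']) (simp_all add: t'(1))
    next
      case 2
      obtain e l r where c: "([e], [l, r]) \<in> cells ?Q" "c = ([l, r], [e])" "e \<in> arcs (graph ?Q)"
        using Q'[OF 2(1)] by blast
      obtain l' r' where c': "([e], [l', r']) \<in> cells ?P" "e \<in> arcs (graph ?P)"
        using P[OF 2(2)] 2(2) c(2) cc(3) by auto
      have "e \<in> set (bot_path ?P)" using c(3) c'(2) gl(8) by blast
      then show ?thesis using cell_top_not_bot[OF gl(1) c'(1)] by blast
    qed
  qed
qed

section \<open>Tree pairs of elements of F\<close>

lemma finite_dyadic_common_denominator: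
  assumes "finite B" "B \<subseteq> dyadic"
  shows "\<exists>N. \<forall>p\<in>B. \<exists>m::int. p = of_int m / 2 ^ N"
  using assms
proof induction
  case (insert p B)
  obtain N where N: "\<And>q. q \<in> B \<Longrightarrow> \<exists>m::int. q = of_int m / 2 ^ N" using insert by auto
  obtain m :: int and n where p: "p = of_int m / 2 ^ n" using insert.prems by (auto simp: dyadic_def)
  have scale: "\<exists>m'::int. (of_int m :: real) / 2 ^ n = of_int m' / 2 ^ (n + k)" for m :: int and n k
    by (rule exI[of _ "m * 2 ^ k"]) (simp add: power_add)
  have "\<exists>m::int. q = of_int m / 2 ^ (N + n)" if "q \<in> insert p B" for q
  proof (cases "q = p")
    case True
    then show ?thesis using scale[of m n N] p by (simp add: add.commute)
  next
    case False
    then show ?thesis using N[of q] scale[of _ N n] that by auto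
  qed
  then show ?case by blast
qed simp

text \<open>On every leaf interval of \<open>t\<close>, \<open>g\<close> is affine and increases by the same amount \<open>w\<close>.  For \<open>g\<close> in \<open>F\<close>, a tree on
  the unit interval and \<open>w = 1 / 2 ^ L\<close>, the images of the leaf intervals are those of the
  full tree of depth \<open>L\<close>.\<close>
definition leaves_rise :: "(real \<Rightarrow> real) \<Rightarrow> real \<Rightarrow> bintree \<Rightarrow> real \<Rightarrow> real \<Rightarrow> bool" where
  "leaves_rise g w t a b \<longleftrightarrow> (\<forall>(c, d)\<in>set (leaf_intervals t a b). affine_piece g c d (g c) (g c + w))"

lemma leaves_rise_Caret:
  "leaves_rise g w t a ((a + b) / 2) \<Longrightarrow> leaves_rise g w u ((a + b) / 2) b \<Longrightarrow>
     leaves_rise g w (Caret t u) a b"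
  by (auto simp: leaves_rise_def)

primrec full_tree :: "nat \<Rightarrow> bintree" where
  "full_tree 0 = Leaf"
| "full_tree (Suc n) = Caret (full_tree n) (full_tree n)"

lemma leaf_count_full_tree [simp]: "leaf_count (full_tree n) = 2 ^ n"
  by (induction n) simp_all

lemma leaf_intervals_full_tree:
  "i < 2 ^ n \<Longrightarrow> leaf_intervals (full_tree n) a b ! i =
     (a + real i * (b - a) / 2 ^ n, a + real (Suc i) * (b - a) / 2 ^ n)"
proof (induction n arbitrary: a b i)
  case (Suc n)
  show ?case
  proof (cases "i < 2 ^ n")
    case True
    then show ?thesis using Suc.IH[OF True, of a "(a + b) / 2"] by (simp add: nth_append field_simps)
  next
    case False
    define k where "k = i - 2 ^ n"
    have i: "i = k + 2 ^ n" "k < 2 ^ n" using False Suc.prems by (auto simp: k_def)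
    show ?thesis using Suc.IH[OF i(2), of "(a + b) / 2" b] by (simp add: nth_append i(1) field_simps)
  qed
qed simp

text \<open>If \<open>g\<close> is affine on the whole interval, halving the interval \<open>n\<close> times divides the increment by
  \<open>2 ^ n\<close>.\<close>
lemma leaves_rise_full_tree:
  assumes "a < b" "\<forall>x\<in>{a..b}. g x = s * x + c" "s * (b - a) = 2 ^ n * w"
  shows "leaves_rise g w (full_tree n) a b"
  using assms
proof (induction n arbitrary: a b)
  case 0
  have slope: "(g a + w - g a) / (b - a) = s" using 0(1,3) by (simp add: nonzero_divide_eq_eq)
  have "g a = s * a + c" using 0(1,2) by simp
  then have "g x = g a + s * (x - a)" if "x \<in> {a..b}" for x
    using 0(2) that by (simp add: algebra_simps)
  then have "affine_piece g a b (g a) (g a + w)" unfolding affine_piece_def slope by blast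
  then show ?case by (simp add: leaves_rise_def)
next
  case (Suc n)
  have "leaves_rise g w (full_tree n) a ((a + b) / 2)"
    by (rule Suc.IH) (use Suc.prems in \<open>auto simp: field_simps\<close>)
  moreover have "leaves_rise g w (full_tree n) ((a + b) / 2) b"
    by (rule Suc.IH) (use Suc.prems in \<open>auto simp: field_simps\<close>)
  ultimately show ?case by (simp add: leaves_rise_Caret)
qed

lemma leaves_rise_values:
  assumes "leaves_rise g w t a b" "a < b"
  shows "g b = g a + real (leaf_count t) * w \<and>
    (\<forall>i<leaf_count t. g (fst (leaf_intervals t a b ! i)) = g a + real i * w)"
  using assms
proof (induction t arbitrary: a b)
  case Leaf
  then have "affine_piece g a b (g a) (g a + w)" by (simp add: leaves_rise_def)
  then show ?case using affine_piece_ends(2)[of g a b] Leaf(2) by simp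
next
  case (Caret t u)
  let ?m = "(a + b) / 2"
  have m: "a < ?m" "?m < b" using Caret.prems(2) by simp_all
  have "leaves_rise g w t a ?m" "leaves_rise g w u ?m b"
    using Caret.prems(1) by (auto simp: leaves_rise_def)
  note t = Caret.IH(1)[OF this(1) m(1)] and u = Caret.IH(2)[OF this(2) m(2)]
  show ?case
  proof (intro conjI allI impI)
    show "g b = g a + real (leaf_count (Caret t u)) * w" using t u by (simp add: algebra_simps)
    fix i assume i: "i < leaf_count (Caret t u)"
    show "g (fst (leaf_intervals (Caret t u) a b ! i)) = g a + real i * w"
    proof (cases "i < leaf_count t")
      case True
      then show ?thesis using t by (simp add: nth_append)
    next
      case False
      define k where "k = i - leaf_count t"
      have "i = leaf_count t + k" "k < leaf_count u" using False i by (auto simp: k_def)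
      then show ?thesis using t u by (simp add: nth_append algebra_simps)
    qed
  qed
qed

text \<open>Trees for all standard intervals of level \<open>k + m\<close> are joined by carets to trees for those of level
  \<open>k\<close>.\<close>
lemma leaves_rise_standard:
  assumes "\<And>j. j < 2 ^ (k + m) \<Longrightarrow> \<exists>t. leaves_rise g w t (real j / 2 ^ (k + m)) (real (Suc j) / 2 ^ (k + m))"
    and "j < 2 ^ k"
  shows "\<exists>t. leaves_rise g w t (real j / 2 ^ k) (real (Suc j) / 2 ^ k)"
  using assms
proof (induction m arbitrary: k j)
  case (Suc m)
  have IH: "\<exists>t. leaves_rise g w t (real i / 2 ^ Suc k) (real (Suc i) / 2 ^ Suc k)" if "i < 2 ^ Suc k" for i
    by (rule Suc.IH) (use Suc.prems(1) that in simp_all)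
  obtain t where t: "leaves_rise g w t (real (2 * j) / 2 ^ Suc k) (real (Suc (2 * j)) / 2 ^ Suc k)"
    using IH[of "2 * j"] Suc.prems(2) by auto
  obtain u where u: "leaves_rise g w u (real (Suc (2 * j)) / 2 ^ Suc k) (real (Suc (Suc (2 * j))) / 2 ^ Suc k)"
    using IH[of "Suc (2 * j)"] Suc.prems(2) by auto
  have eqs: "real (2 * j) / 2 ^ Suc k = real j / 2 ^ k"
    "real (Suc (2 * j)) / 2 ^ Suc k = (real j / 2 ^ k + real (Suc j) / 2 ^ k) / 2"
    "real (Suc (Suc (2 * j))) / 2 ^ Suc k = real (Suc j) / 2 ^ k"
    by (simp_all add: field_simps)
  show ?case using leaves_rise_Caret[OF t[unfolded eqs(1,2)] u[unfolded eqs(2,3)]] by blast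
qed simp

text \<open>The bottom tree can be taken to be a full tree, if its depth \<open>L\<close> is large: when \<open>g\<close> has slope
  \<open>2 ^ K j\<close> on the \<open>j\<close>-th standard interval of level \<open>N\<close>, it increases there by \<open>2 ^ (K j - N)\<close>, a
  multiple of \<open>1 / 2 ^ L\<close> by a power of two, so the interval is halved \<open>L + K j - N\<close> times.\<close>
lemma thompson_F_tree_pair:
  assumes "g \<in> thompson_F"
  shows "\<exists>t u. tree_pair_map t u g"
proof -
  have "\<exists>B\<subseteq>dyadic. finite B \<and> (\<forall>a b. 0 \<le> a \<and> a < b \<and> b \<le> 1 \<and> {a<..<b} \<inter> B = {} \<longrightarrow>
      (\<exists>(k::int) c. \<forall>x\<in>{a..b}. g x = 2 powi k * x + c))"
    using assms by (simp add: thompson_F_def)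
  then obtain B where B: "B \<subseteq> dyadic" "finite B"
    and p: "\<forall>a b. 0 \<le> a \<and> a < b \<and> b \<le> 1 \<and> {a<..<b} \<inter> B = {} \<longrightarrow>
      (\<exists>(k::int) c. \<forall>x\<in>{a..b}. g x = 2 powi k * x + c)"
    by (elim exE conjE) (rule that)
  have pieces: "\<exists>(k::int) c. \<forall>x\<in>{a..b}. g x = 2 powi k * x + c"
    if "0 \<le> a" "a < b" "b \<le> 1" "{a<..<b} \<inter> B = {}" for a b
    using p[rule_format, of a b] that by simp
  obtain N where N: "\<And>p. p \<in> B \<Longrightarrow> \<exists>m::int. p = of_int m / 2 ^ N"
    using finite_dyadic_common_denominator[OF B(2,1)] by blast
  have "\<exists>(k::int) c. \<forall>x\<in>{real j / 2 ^ N..real (Suc j) / 2 ^ N}. g x = 2 powi k * x + c"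
    if "j < 2 ^ N" for j
  proof (rule pieces)
    show "0 \<le> real j / 2 ^ N" "real j / 2 ^ N < real (Suc j) / 2 ^ N"
      by (simp_all add: divide_strict_right_mono)
    have "real (Suc j) \<le> real (2 ^ N)" using that by (simp only: of_nat_le_iff Suc_le_eq)
    then show "real (Suc j) / 2 ^ N \<le> 1" by simp
    have "p \<notin> B" if "real j / 2 ^ N < p" "p < real (Suc j) / 2 ^ N" for p
    proof
      assume "p \<in> B"
      then obtain m :: int where "p = of_int m / 2 ^ N" using N by blast
      with that have "real j < of_int m" "of_int m < real (Suc j)" by (simp_all add: divide_less_cancel)
      then have "of_int (int j) < (of_int m :: real)" "of_int m < (of_int (int j + 1) :: real)" by simp_all
      then have "int j < m" "m < int j + 1" by (simp_all only: of_int_less_iff)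
      then show False by simp
    qed
    then show "{real j / 2 ^ N<..<real (Suc j) / 2 ^ N} \<inter> B = {}" by auto
  qed
  then obtain K :: "nat \<Rightarrow> int" where K: "\<And>j. j < 2 ^ N \<Longrightarrow>
      \<exists>c. \<forall>x\<in>{real j / 2 ^ N..real (Suc j) / 2 ^ N}. g x = 2 powi K j * x + c"
    by metis
  \<comment> \<open>\<open>S\<close> bounds all exponents, so that \<open>L + K j - N\<close> is never negative.\<close>
  define S where "S = (\<Sum>j<2 ^ N. nat \<bar>K j\<bar>)"
  define L where "L = N + S"
  define w :: real where "w = 1 / 2 ^ L"
  have fine: "\<exists>t. leaves_rise g w t (real j / 2 ^ N) (real (Suc j) / 2 ^ N)" if j: "j < 2 ^ N" for j
  proof -
    obtain c where c: "\<forall>x\<in>{real j / 2 ^ N..real (Suc j) / 2 ^ N}. g x = 2 powi K j * x + c"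
      using K[OF j] by blast
    have "nat \<bar>K j\<bar> \<le> S" unfolding S_def using j by (intro member_le_sum) auto
    then have "0 \<le> int L + K j - int N" unfolding L_def by linarith
    then obtain n where n: "int L + K j - int N = int n" using zero_le_imp_eq_int by blast
    then have "K j = int n + int N - int L" by simp
    then have "(2::real) powi K j = 2 ^ n * 2 ^ N / 2 ^ L" by (simp add: power_int_diff power_int_add)
    then have "2 powi K j * (real (Suc j) / 2 ^ N - real j / 2 ^ N) = 2 ^ n * w"
      by (simp add: w_def field_simps)
    moreover have "real j / 2 ^ N < real (Suc j) / 2 ^ N" by (simp add: divide_strict_right_mono)
    ultimately have "leaves_rise g w (full_tree n) (real j / 2 ^ N) (real (Suc j) / 2 ^ N)"
      using c by (intro leaves_rise_full_tree) 
    then show ?thesis by blast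
  qed
  have "\<exists>t. leaves_rise g w t (real 0 / 2 ^ 0) (real (Suc 0) / 2 ^ 0)"
    by (rule leaves_rise_standard[of 0 N]) (use fine in simp_all)
  then obtain t where t: "leaves_rise g w t 0 1" by auto
  have vals: "g 1 = g 0 + real (leaf_count t) * w"
    "\<And>i. i < leaf_count t \<Longrightarrow> g (fst (leaf_intervals t 0 1 ! i)) = g 0 + real i * w"
    using leaves_rise_values[OF t] by auto
  note ends = thompson_F_ends[OF assms]
  have "real (leaf_count t) = real (2 ^ L)" using vals(1) ends by (simp add: w_def field_simps)
  then have count: "leaf_count t = 2 ^ L" by (simp only: of_nat_eq_iff)
  have "tree_pair_map t (full_tree L) g"
    unfolding tree_pair_map_def
  proof (rule list_all2_all_nthI)
    fix i assume "i < length (leaf_intervals t 0 1)"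
    then have i: "i < leaf_count t" "i < 2 ^ L" by (simp_all add: count)
    obtain c d where cd: "leaf_intervals t 0 1 ! i = (c, d)" by fastforce
    then have "(c, d) \<in> set (leaf_intervals t 0 1)" using i(1) by (metis length_leaf_intervals nth_mem)
    then have "affine_piece g c d (g c) (g c + w)" using t by (auto simp: leaves_rise_def)
    moreover have "g c = real i * w" using vals(2)[OF i(1)] ends cd by simp
    moreover have "leaf_intervals (full_tree L) 0 1 ! i = (real i * w, real i * w + w)"
      using leaf_intervals_full_tree[OF i(2), of 0 1] by (simp add: w_def field_simps)
    ultimately show "(\<lambda>(a, b) (c, d). affine_piece g a b c d) (leaf_intervals t 0 1 ! i)
        (leaf_intervals (full_tree L) 0 1 ! i)" by (simp add: cd)
  qed (simp add: count)
  then show ?thesis by blast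
qed

section \<open>Jones' subgroup as a stabilizer\<close>

theorem theorem2:
  shows "jones_subgroup = stabilizer_F odd_digit_sum_dyadics"
proof (intro equalityI subsetI)
  fix g assume "g \<in> jones_subgroup"
  then obtain D where D: "diagram_in_F D" "bipartite (thompson_graph D)" "represents D g"
    by (auto simp: jones_subgroup_def)
  obtain P Q where "D = dmult P (dinv Q)" "glueable P Q" "pair_map P Q g"
    using represents_pair[OF D(1,3)] .
  then show "g \<in> stabilizer_F odd_digit_sum_dyadics"
    using D(2) bipartite_iff_stabilizer by simp
next
  fix g assume g: "g \<in> stabilizer_F odd_digit_sum_dyadics"
  then have F: "g \<in> thompson_F" by (simp add: stabilizer_F_def)
  then have id: "\<forall>x. x \<notin> {0..1} \<longrightarrow> g x = x" by (simp add: thompson_F_def)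
  obtain t u where tu: "tree_pair_map t u g"
    "reduced (dmult (tree_diagram 0 t 0) (dinv (tree_diagram 1 u 0)))"
    using thompson_F_tree_pair[OF F] reduced_tree_pair_exists by blast
  have "bipartite (thompson_graph (dmult (tree_diagram 0 t 0) (dinv (tree_diagram 1 u 0))))"
    using bipartite_iff_stabilizer[OF glueable_trees tree_pair_map_diagrams[OF tu(1) id]]
      tree_pair_map_leaf_count[OF tu(1)] g by blast
  then show "g \<in> jones_subgroup"
    unfolding jones_subgroup_def using tu(2) trees_represent[OF tu(1) id] by blast
qed

end
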